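(* Let $n\geq 2$ be an integer and set $\nu_n=\left\lfloor \frac{n-1}{2}\right\rfloor-1$. Then the multipath complex $X(\mathtt{BP}_n)$ of the bidirectional polygonal digraph $\mathtt{BP}_n$ on $n+1$ vertices is $\nu_n$-connected.
   Context: A digraph has at most one edge $(v,w)$ from $v$ to $w$ for each ordered pair of vertices (so between two distinct vertices there are at most two edges, going in opposite directions). For an edge $e=(v,w)$, $s(e)=v$ is its source and $t(e)=w$ its target. A simple path in a digraph is a sequence of edges $e_1,\dots,e_k$ with $s(e_{i+1})=t(e_i)$ for all $i<k$, such that $s(e_i)=s(e_j)$ or $t(e_i)=t(e_j)$ implies $i=j$, and which is not a cycle, i.e. $s(e_1)\neq t(e_k)$. A multipath of a digraph $G$ is a spanning subgraph each of whose connected components is either a single vertex or a simple path. The multipath complex $X(G)$ is the (abstract) simplicial complex whose simplices are the nonempty edge sets of multipaths of $G$ (the empty simplex corresponds to the multipath with no edges); topological statements refer to its geometric realization. The bidirectional polygonal digraph $\mathtt{BP}_n$ has $n+1$ vertices $0,1,\dots,n$ and the $2n+2$ edges $(i,i+1)$ and $(i+1,i)$, with $i$ taken modulo $n+1$. Convention: a space is $k$-connected if it is nonempty and its homotopy groups $\pi_j$ vanish for all $0\le j\leq k$ (so $(-1)$-connected means nonempty). *)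

theory Defs
  imports "HOL-Analysis.Analysis" "Graph_Theory.Digraph_Component"
begin

section \<open>Multipaths\<close>

definition simple_dipath :: "('a \<times> 'a) list \<Rightarrow> bool" where
  "simple_dipath es \<longleftrightarrow>
     es \<noteq> [] \<and>
     (\<forall>i. Suc i < length es \<longrightarrow> fst (es ! Suc i) = snd (es ! i)) \<and>
     (\<forall>i < length es. \<forall>j < length es.
        fst (es ! i) = fst (es ! j) \<or> snd (es ! i) = snd (es ! j) \<longrightarrow> i = j) \<and>
     fst (hd es) \<noteq> snd (last es)"

definition is_single_vertex :: "('a, 'a \<times> 'a) pre_digraph \<Rightarrow> bool" where
  "is_single_vertex C \<longleftrightarrow> (\<exists>v. verts C = {v}) \<and> arcs C = {}"

definition is_simple_dipath :: "('a, 'a \<times> 'a) pre_digraph \<Rightarrow> bool" where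
  "is_simple_dipath C \<longleftrightarrow>
     (\<exists>es. simple_dipath es \<and> arcs C = set es \<and> verts C = fst ` set es \<union> snd ` set es)"

text \<open>Components are those of the underlying undirected graph. The qualified name selects
  (weak) connectedness of digraphs, not connectedness of topological spaces.\<close>

definition component_of :: "('a, 'b) pre_digraph \<Rightarrow> ('a, 'b) pre_digraph \<Rightarrow> bool" where
  "component_of C H \<longleftrightarrow> pre_digraph.max_subgraph H Digraph_Component.connected C"

definition multipath :: "'a pair_pre_digraph \<Rightarrow> 'a pair_pre_digraph \<Rightarrow> bool" where
  "multipath H G \<longleftrightarrow>
     spanning (with_proj H) (with_proj G) \<and>
     (\<forall>C. component_of C (with_proj H) \<longrightarrow> is_single_vertex C \<or> is_simple_dipath C)"

definition multipath_complex :: "'a pair_pre_digraph \<Rightarrow> ('a \<times> 'a) set set" where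
  "multipath_complex G = {parcs H |H. multipath H G \<and> parcs H \<noteq> {}}"

definition BP :: "nat \<Rightarrow> nat pair_pre_digraph" where
  "BP n = \<lparr> pverts = {0..n},
            parcs = (\<Union>i \<in> {0..n}. {(i, (i + 1) mod (n + 1)), ((i + 1) mod (n + 1), i)}) \<rparr>"


section \<open>Geometric realization\<close>

text \<open>An abstract simplicial complex is given by its set of nonempty simplices; a point of the
  realization is given by its barycentric coordinates, extended by zero to the whole type. The
  topology is the one induced from the product topology, as for \<open>standard_simplex\<close> in the library.
  For complexes with finitely many simplices, each of them finite, this is the usual (coherent)
  topology; for infinite complexes it need not be.\<close>

definition realization_points :: "'v set set \<Rightarrow> ('v \<Rightarrow> real) set" where
  "realization_points K =
     {a. {v. a v \<noteq> 0} \<in> K \<and> (\<forall>v. 0 \<le> a v) \<and> (\<Sum>v | a v \<noteq> 0. a v) = 1}"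

definition geometric_realization :: "'v set set \<Rightarrow> ('v \<Rightarrow> real) topology" where
  "geometric_realization K = subtopology (powertop_real UNIV) (realization_points K)"


section \<open>Homotopy groups and connectedness\<close>

definition cube :: "nat \<Rightarrow> (nat \<Rightarrow> real) topology" where
  "cube j = product_topology (\<lambda>_. top_of_set {0..1}) {..<j}"

definition cube_boundary :: "nat \<Rightarrow> (nat \<Rightarrow> real) set" where
  "cube_boundary j = {c \<in> topspace (cube j). \<exists>i<j. c i = 0 \<or> c i = 1}"

definition boundary_at :: "nat \<Rightarrow> 'x \<Rightarrow> ((nat \<Rightarrow> real) \<Rightarrow> 'x) \<Rightarrow> bool" where
  "boundary_at j x f \<longleftrightarrow> (\<forall>c \<in> cube_boundary j. f c = x)"

definition based_cubes :: "nat \<Rightarrow> 'x topology \<Rightarrow> 'x \<Rightarrow> ((nat \<Rightarrow> real) \<Rightarrow> 'x) set" where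
  "based_cubes j X x = {f. continuous_map (cube j) X f \<and> boundary_at j x f}"

definition based_homotopy ::
  "nat \<Rightarrow> 'x topology \<Rightarrow> 'x \<Rightarrow> (((nat \<Rightarrow> real) \<Rightarrow> 'x) \<times> ((nat \<Rightarrow> real) \<Rightarrow> 'x)) set" where
  "based_homotopy j X x =
     {(f, g). f \<in> based_cubes j X x \<and> g \<in> based_cubes j X x \<and>
              homotopic_with (boundary_at j x) (cube j) X f g}"

lemma equiv_based_homotopy: "equiv (based_cubes j X x) (based_homotopy j X x)"
proof (rule equivI)
  show "based_homotopy j X x \<subseteq> based_cubes j X x \<times> based_cubes j X x"
    by (auto simp: based_homotopy_def)
  show "refl_on (based_cubes j X x) (based_homotopy j X x)"
    by (auto simp: refl_on_def based_homotopy_def based_cubes_def)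
  show "sym (based_homotopy j X x)"
    by (auto simp: sym_def based_homotopy_def homotopic_with_sym)
  show "trans (based_homotopy j X x)"
    by (auto simp: trans_def based_homotopy_def intro: homotopic_with_trans)
qed

text \<open>The underlying set of \<open>\<pi>\<^sub>j(X, x)\<close>, as homotopy classes of maps of pairs from
  \<open>(I\<^sup>j, \<partial>I\<^sup>j)\<close> to \<open>(X, x)\<close>. Since \<open>I\<^sup>0\<close> is a point with empty boundary, \<open>\<pi>\<^sub>0(X, x)\<close> is
  the set of path components of \<open>X\<close>. The group structure (for positive \<open>j\<close>) plays no role in
  vanishing, which means that the class of the constant map is the only element.\<close>

definition homotopy_classes :: "nat \<Rightarrow> 'x topology \<Rightarrow> 'x \<Rightarrow> ((nat \<Rightarrow> real) \<Rightarrow> 'x) set set" where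
  "homotopy_classes j X x = based_cubes j X x // based_homotopy j X x"

definition homotopy_group_vanishes :: "nat \<Rightarrow> 'x topology \<Rightarrow> 'x \<Rightarrow> bool" where
  "homotopy_group_vanishes j X x \<longleftrightarrow>
     homotopy_classes j X x = {based_homotopy j X x `` {\<lambda>_. x}}"

definition k_connected :: "int \<Rightarrow> 'x topology \<Rightarrow> bool" where
  "k_connected k X \<longleftrightarrow>
     topspace X \<noteq> {} \<and>
     (\<forall>j::nat. int j \<le> k \<longrightarrow> (\<forall>x \<in> topspace X. homotopy_group_vanishes j X x))"

end

theory Submission
  imports Defs
begin

text \<open>
  A multipath of \<open>BP n\<close> is a set of clockwise edges \<open>(True, i)\<close> and counterclockwise edges
  \<open>(False, i)\<close>, \<open>i \<le> n\<close>, that contains no two opposite edges at cyclic distance at most 1 and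
  not all edges of one direction. Vertices are added to such complexes one at a time: if the deletion
  of a vertex is \<open>k\<close>-connected and its link is \<open>(k - 1)\<close>-connected, then the complex is
  \<open>k\<close>-connected. Without the two edges at position \<open>n\<close> what remains is the complex of a strip of
  \<open>n\<close> positions, which is built up by suspensions, each of them using up two positions; the links
  of the two last edges are handled by a similar recursion.

  The step from deletion and link to the complex is a gluing argument for an open cover of the
  realization by two sets. A map on the boundary of a cube is extended over the cells of a grid so
  fine that each top cell meets the boundary in a set mapped into one of the two sets; cells lying
  between differently labelled top cells have smaller dimension and are mapped into the intersection.
\<close>

section \<open>Filling maps on the boundary of a cube\<close>

text \<open>The complex is not determined by its edges: the \<open>n + 1\<close> arcs of one
  direction are pairwise compatible, yet together they form a directed cycle and not a simplex.
  Independence complexes of conflict graphs therefore do not cover the links that occur, and a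
  variant with one forbidden set of vertices is carried along; the prohibition becomes void as soon
  as one vertex of that set is deleted. The result concerns homotopy groups, so a Mayer-Vietoris
  sequence would have to be supplemented by arguments on the fundamental group. Extending maps from
  the boundary of a cube to the cube avoids this: one statement without base points covers
  nonemptiness, path connectedness and all higher groups, and it passes through open covers with a
  plain dimension count. The number \<open>(n + 1) div 2\<close> in the final step is the largest
  \<open>q\<close> with \<open>2 * q \<le> n + 1\<close>. Both the strip left after the deletions
  and the links of the deleted sides lead to exactly this inequality.\<close>

abbreviation unit_cube :: "nat \<Rightarrow> (nat \<Rightarrow> real) set" where
  "unit_cube j \<equiv> PiE {..<j} (\<lambda>_. {0..1})"

section \<open>The cube as a subspace of the function space\<close>

lemma continuous_on_apply: "continuous_on S (\<lambda>x. x i)"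
  for S :: "('b \<Rightarrow> 'c::topological_space) set"
  by (rule continuous_on_product_then_coordinatewise) (rule continuous_on_id)

lemma topspace_cube: "topspace (cube j) = unit_cube j"
  by (simp add: cube_def)

text \<open>The identity is continuous in both directions: coordinates below \<open>j\<close> are
  projections, and the others are constantly \<open>undefined\<close> on the cube. This gives access
  to \<open>continuous_on\<close> in place of \<open>continuous_map\<close>.\<close>

lemma cube_eq: "cube j = top_of_set (unit_cube j)"
proof (rule topology_eq[THEN iffD2], intro allI)
  have 1: "continuous_map (cube j) (top_of_set (unit_cube j)) (\<lambda>x. x)"
  proof -
    have "continuous_map (cube j) euclidean (\<lambda>x. x)"
      unfolding euclidean_product_topology[symmetric]
    proof (subst continuous_map_componentwise_UNIV, intro allI)
      fix i
      show "continuous_map (cube j) euclideanreal (\<lambda>x. x i)"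
      proof (cases "i < j")
        case True
        then have "continuous_map (cube j) (top_of_set {0..1}) (\<lambda>x. x i)"
          unfolding cube_def by (intro continuous_map_product_projection) auto
        then show ?thesis using continuous_map_into_fulltopology by blast
      next
        case False
        have "continuous_map (cube j) euclideanreal (\<lambda>x. undefined)" by simp
        then show ?thesis
          by (rule continuous_map_eq) (use False in \<open>auto simp: topspace_cube PiE_def extensional_def\<close>)
      qed
    qed
    then show ?thesis
      by (auto simp: continuous_map_in_subtopology topspace_cube)
  qed
  have 2: "continuous_map (top_of_set (unit_cube j)) (cube j) (\<lambda>x. x)"
    unfolding cube_def continuous_map_componentwise
  proof (intro conjI ballI)
    fix i assume "i \<in> {..<j}"
    then show "continuous_map (top_of_set (unit_cube j)) (top_of_set {0..1}) (\<lambda>x. x i)"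
      by (auto simp: continuous_map_in_subtopology continuous_on_apply)
  qed (simp add: PiE_def Pi_iff)
  fix U
  show "openin (cube j) U = openin (top_of_set (unit_cube j)) U"
  proof
    assume "openin (cube j) U"
    moreover from this have "{x \<in> topspace (top_of_set (unit_cube j)). x \<in> U} = U"
      using openin_subset[of "cube j" U] topspace_cube by auto
    ultimately show "openin (top_of_set (unit_cube j)) U"
      using openin_continuous_map_preimage[OF 2, of U] by simp
  next
    assume U: "openin (top_of_set (unit_cube j)) U"
    moreover from this have "{x \<in> topspace (cube j). x \<in> U} = U"
      using openin_subset[OF U] topspace_cube by auto
    ultimately show "openin (cube j) U"
      using openin_continuous_map_preimage[OF 1, of U] by simp
  qed
qed

lemma cube_boundary_eq: "cube_boundary j = {x \<in> unit_cube j. \<exists>i<j. x i = 0 \<or> x i = 1}"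
  by (simp add: cube_boundary_def topspace_cube)

text \<open>The index is shifted by two: \<open>fills q S\<close> says that \<open>S\<close> is \<open>(q - 2)\<close>-connected. Thus \<open>fills 0\<close>
  holds for every set, and \<open>fills 1\<close> for the nonempty ones, since \<open>cube_boundary 0\<close> is empty.\<close>

definition fills :: "nat \<Rightarrow> 'a::topological_space set \<Rightarrow> bool" where
  "fills q S \<longleftrightarrow> (\<forall>j<q. \<forall>f. continuous_on (cube_boundary j) f \<and> f \<in> cube_boundary j \<rightarrow> S \<longrightarrow>
     (\<exists>g. continuous_on (unit_cube j) g \<and> g \<in> unit_cube j \<rightarrow> S \<and> (\<forall>x\<in>cube_boundary j. g x = f x)))"

lemma fillsD:
  assumes "fills q S" "j < q" "continuous_on (cube_boundary j) f" "f \<in> cube_boundary j \<rightarrow> S"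
  obtains g where "continuous_on (unit_cube j) g" "g \<in> unit_cube j \<rightarrow> S"
    "\<And>x. x \<in> cube_boundary j \<Longrightarrow> g x = f x"
  using that assms(1)[unfolded fills_def, rule_format, OF assms(2) conjI[OF assms(3,4)]] by auto

text \<open>Twice the distance from the centre in the maximum norm, scaled so that for
  \<open>j > 0\<close> the boundary of the cube is the sphere of radius 1 in the cube.\<close>

primrec radius :: "nat \<Rightarrow> (nat \<Rightarrow> real) \<Rightarrow> real" where
  "radius 0 x = 0"
| "radius (Suc j) x = max (radius j x) \<bar>2 * x j - 1\<bar>"

lemma radius_ge: "i < j \<Longrightarrow> \<bar>2 * x i - 1\<bar> \<le> radius j x"
  by (induction j) (auto simp: less_Suc_eq)

lemma radius_attained: "0 < j \<Longrightarrow> \<exists>i<j. radius j x = \<bar>2 * x i - 1\<bar>"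
proof (induction j)
  case (Suc j)
  then show ?case
    by (cases "j = 0") (force simp: max_def less_Suc_eq)+
qed simp

lemma continuous_on_radius: "continuous_on S (radius j)"
  by (induction j) (auto intro!: continuous_intros continuous_on_apply)

lemma continuous_on_restrict_fun:
  fixes f :: "'a::topological_space \<Rightarrow> 'b \<Rightarrow> 'c::topological_space"
  assumes "\<And>i. i \<in> I \<Longrightarrow> continuous_on S (\<lambda>x. f x i)"
  shows "continuous_on S (\<lambda>x. restrict (f x) I)"
proof (rule continuous_on_coordinatewise_then_product)
  fix i show "continuous_on S (\<lambda>x. restrict (f x) I i)"
    using assms by (cases "i \<in> I") auto
qed

text \<open>The homotopy is run through on the shell between radius 1/2 and radius 1 of the cube.\<close>

lemma fill_homotopy:
  fixes H :: "real \<times> (nat \<Rightarrow> real) \<Rightarrow> 'a::topological_space"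
  assumes H: "continuous_on ({0..1} \<times> cube_boundary j) H" "H \<in> {0..1} \<times> cube_boundary j \<rightarrow> S"
    and g: "continuous_on (unit_cube j) g" "g \<in> unit_cube j \<rightarrow> S"
    and gH: "\<And>x. x \<in> cube_boundary j \<Longrightarrow> g x = H (1, x)"
  obtains h where "continuous_on (unit_cube j) h" "h \<in> unit_cube j \<rightarrow> S"
    "\<And>x. x \<in> cube_boundary j \<Longrightarrow> h x = H (0, x)"
proof (cases "j = 0")
  case True
  with g that show ?thesis by (auto simp: cube_boundary_eq)
next
  case False
  \<comment> \<open>\<open>dil\<close> blows up the inner cube of radius 1/2 to the whole cube, and
    \<open>proj\<close> projects from the centre onto the boundary. At radius 1/2 both are dilation
    by the factor 2; the time \<open>2 * (1 - radius j x)\<close> is 1 there and 0 on the boundary,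
    so the two pieces match by \<open>gH\<close>.\<close>
  define dil where "dil x = restrict (\<lambda>i. 1/2 + 2 * (x i - 1/2)) {..<j}" for x :: "nat \<Rightarrow> real"
  define proj where "proj x = restrict (\<lambda>i. 1/2 + (x i - 1/2) / radius j x) {..<j}" for x
  define h where "h x = (if radius j x \<le> 1/2 then g (dil x) else H (2 * (1 - radius j x), proj x))" for x
  have r1: "radius j x \<le> 1" if "x \<in> unit_cube j" for x
  proof -
    obtain i where "i < j" "radius j x = \<bar>2 * x i - 1\<bar>" using radius_attained False by blast
    moreover have "0 \<le> x i" "x i \<le> 1" using that \<open>i < j\<close> by (auto simp: PiE_iff)
    ultimately show ?thesis by linarith
  qed
  have rb: "radius j x = 1" if x: "x \<in> cube_boundary j" for x
  proof -
    obtain i where "i < j" "x i = 0 \<or> x i = 1" using x unfolding cube_boundary_eq by blast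
    moreover have "radius j x \<le> 1" using x r1 by (simp add: cube_boundary_eq)
    ultimately show ?thesis using radius_ge[of i j x] by auto
  qed
  have dilA: "dil x \<in> unit_cube j" if "radius j x \<le> 1/2" for x
  proof -
    have "0 \<le> 1/2 + 2 * (x i - 1/2) \<and> 1/2 + 2 * (x i - 1/2) \<le> 1" if "i < j" for i
      using radius_ge[OF that, of x] \<open>radius j x \<le> 1/2\<close> by (auto simp: abs_le_iff)
    then show ?thesis by (auto simp: dil_def)
  qed
  have projB: "proj x \<in> cube_boundary j" if "1/2 \<le> radius j x" for x
  proof -
    have pos: "radius j x > 0" using that by simp
    have "0 \<le> 1/2 + (x i - 1/2) / radius j x \<and> 1/2 + (x i - 1/2) / radius j x \<le> 1" if "i < j" for i
      using radius_ge[OF that, of x] pos by (auto simp: field_simps abs_le_iff)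
    then have "proj x \<in> unit_cube j" by (auto simp: proj_def)
    moreover obtain i where "i < j" "radius j x = \<bar>2 * x i - 1\<bar>" using radius_attained False by blast
    moreover from this have "proj x i = 0 \<or> proj x i = 1"
      using pos by (cases "2 * x i \<ge> 1") (auto simp: proj_def abs_if field_simps)
    ultimately show ?thesis by (auto simp: cube_boundary_eq)
  qed
  have "continuous_on (unit_cube j) h"
    unfolding h_def
  proof (rule continuous_on_cases_le[OF _ _ continuous_on_radius])
    show "continuous_on {x \<in> unit_cube j. radius j x \<le> 1/2} (\<lambda>x. g (dil x))"
    proof (rule continuous_on_compose2[OF g(1)])
      show "continuous_on {x \<in> unit_cube j. radius j x \<le> 1/2} dil"
        unfolding dil_def[abs_def] by (intro continuous_on_restrict_fun continuous_on_add continuous_on_mult continuous_on_diff continuous_on_const continuous_on_apply)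
    qed (use dilA in auto)
    show "continuous_on {x \<in> unit_cube j. 1/2 \<le> radius j x} (\<lambda>x. H (2 * (1 - radius j x), proj x))"
    proof (rule continuous_on_compose2[OF H(1)])
      show "continuous_on {x \<in> unit_cube j. 1/2 \<le> radius j x} (\<lambda>x. (2 * (1 - radius j x), proj x))"
        unfolding proj_def[abs_def]
        by (intro continuous_on_Pair continuous_on_restrict_fun continuous_on_divide continuous_on_add continuous_on_mult continuous_on_diff continuous_on_const continuous_on_apply continuous_on_radius) auto
    qed (use projB r1 in auto)
    show "g (dil x) = H (2 * (1 - radius j x), proj x)" if "x \<in> unit_cube j" "radius j x = 1/2" for x
    proof -
      have "dil x = proj x" unfolding dil_def proj_def that(2) by (simp add: mult.commute)
      then show ?thesis using gH[OF projB[of x]] by (simp add: that(2))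
    qed
  qed
  moreover have "h \<in> unit_cube j \<rightarrow> S"
    using g(2) H(2) dilA projB r1 by (fastforce simp: h_def Pi_iff)
  moreover have "h x = H (0, x)" if "x \<in> cube_boundary j" for x
  proof -
    have "proj x = x" using that rb[OF that] 
      by (auto simp: proj_def fun_eq_iff cube_boundary_eq PiE_iff extensional_def)
    then show ?thesis using rb[OF that] by (simp add: h_def)
  qed
  ultimately show ?thesis using that by blast
qed

text \<open>The composite of \<open>f\<close> with \<open>p\<close> is filled inside
  \<open>A\<close>, the filling is brought back to \<open>U\<close> by \<open>i\<close>, and the
  segments from \<open>f\<close> to its image under \<open>i\<close> after \<open>p\<close> form the
  homotopy for \<open>fill_homotopy\<close>. Only this one composite is compared with the identity:
  it is enough that \<open>A\<close> dominates \<open>U\<close>.\<close>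

lemma fills_linear_homotopy:
  fixes U :: "('v \<Rightarrow> real) set" and A :: "'a::topological_space set"
  assumes "fills q A"
    and p: "continuous_on U p" "p \<in> U \<rightarrow> A" and i: "continuous_on A i" "i \<in> A \<rightarrow> U"
    and seg: "\<And>a t. a \<in> U \<Longrightarrow> 0 \<le> t \<Longrightarrow> t \<le> 1 \<Longrightarrow> (\<lambda>v. (1 - t) * a v + t * i (p a) v) \<in> U"
  shows "fills q U"
  unfolding fills_def
proof (intro allI impI, elim conjE)
  fix j f assume j: "j < q" and f: "continuous_on (cube_boundary j) f" "f \<in> cube_boundary j \<rightarrow> U"
  obtain g where g: "continuous_on (unit_cube j) g" "g \<in> unit_cube j \<rightarrow> A"
    "\<And>x. x \<in> cube_boundary j \<Longrightarrow> g x = p (f x)"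
  proof (rule fillsD[OF assms(1) j])
    show "continuous_on (cube_boundary j) (\<lambda>x. p (f x))"
      by (rule continuous_on_compose2[OF p(1) f(1)]) (use f(2) in auto)
    show "(\<lambda>x. p (f x)) \<in> cube_boundary j \<rightarrow> A" using f(2) p(2) by auto
  qed (use that in auto)
  define H where "H z = (\<lambda>v. (1 - fst z) * f (snd z) v + fst z * i (p (f (snd z))) v)" for z :: "real \<times> _"
  have f_snd: "continuous_on ({0..1} \<times> cube_boundary j) (\<lambda>z. f (snd z))"
    by (rule continuous_on_compose2[OF f(1) continuous_on_snd[OF continuous_on_id]]) auto
  have pf: "continuous_on ({0..1} \<times> cube_boundary j) (\<lambda>z. i (p (f (snd z))))"
    by (rule continuous_on_compose2[OF i(1) continuous_on_compose2[OF p(1) f_snd]]) (use f p in auto)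
  have "continuous_on ({0..1} \<times> cube_boundary j) H"
    unfolding H_def
    by (intro continuous_on_coordinatewise_then_product continuous_on_add continuous_on_mult
        continuous_on_diff continuous_on_const continuous_on_fst continuous_on_id
        continuous_on_product_then_coordinatewise[OF f_snd] continuous_on_product_then_coordinatewise[OF pf])
  moreover have "H \<in> {0..1} \<times> cube_boundary j \<rightarrow> U"
    using f(2) by (auto simp: H_def Pi_iff intro!: seg)
  moreover have "continuous_on (unit_cube j) (\<lambda>x. i (g x))"
    by (rule continuous_on_compose2[OF i(1) g(1)]) (use g(2) in auto)
  moreover have "(\<lambda>x. i (g x)) \<in> unit_cube j \<rightarrow> U" using g(2) i(2) by auto
  moreover have "i (g x) = H (1, x)" if "x \<in> cube_boundary j" for x
    using g(3)[OF that] by (simp add: H_def)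
  ultimately obtain h where "continuous_on (unit_cube j) h" "h \<in> unit_cube j \<rightarrow> U"
    "\<And>x. x \<in> cube_boundary j \<Longrightarrow> h x = H (0, x)"
    using fill_homotopy[of j H U "\<lambda>x. i (g x)"] by blast
  then show "\<exists>g. continuous_on (unit_cube j) g \<and> g \<in> unit_cube j \<rightarrow> U \<and> (\<forall>x\<in>cube_boundary j. g x = f x)"
    by (intro exI[of _ h]) (auto simp: H_def)
qed

lemma fills_singleton: "fills q {a}"
  unfolding fills_def by (auto intro!: exI[of _ "\<lambda>_. a"] simp: Pi_iff)

lemma fills_star_shaped:
  fixes U :: "('v \<Rightarrow> real) set"
  assumes "c \<in> U" "\<And>a t. a \<in> U \<Longrightarrow> 0 \<le> t \<Longrightarrow> t \<le> 1 \<Longrightarrow> (\<lambda>v. (1 - t) * a v + t * c v) \<in> U"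
  shows "fills q U"
  by (rule fills_linear_homotopy[OF fills_singleton[of q c], where p = "\<lambda>_. c" and i = "\<lambda>x. x"])
    (use assms in \<open>auto intro: continuous_on_const continuous_on_id\<close>)

section \<open>Cubical grids\<close>

text \<open>The unit interval is cut into \<open>N\<close> pieces. In a cell \<open>k\<close>, the entry \<open>k i = 2 * a\<close> stands for the
  point \<open>a / N\<close> in direction \<open>i\<close>, and \<open>k i = 2 * a + 1\<close> for the interval from \<open>a / N\<close> to \<open>(a + 1) / N\<close>.\<close>

definition grid :: "nat \<Rightarrow> nat \<Rightarrow> (nat \<Rightarrow> nat) set" where
  "grid N J = PiE {..<J} (\<lambda>_. {..2 * N})"

definition cell :: "nat \<Rightarrow> nat \<Rightarrow> (nat \<Rightarrow> nat) \<Rightarrow> (nat \<Rightarrow> real) set" where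
  "cell N J k = {x \<in> unit_cube J. \<forall>i<J. real (k i div 2) \<le> real N * x i \<and> real N * x i \<le> real ((k i + 1) div 2)}"

definition cell_dim :: "nat \<Rightarrow> (nat \<Rightarrow> nat) \<Rightarrow> nat" where
  "cell_dim J k = card {i. i < J \<and> odd (k i)}"

text \<open>The inequalities compare left and right end points of the intervals in units of
  \<open>1 / N\<close>, so that inclusion of cells becomes arithmetic on indices.\<close>

definition is_face :: "nat \<Rightarrow> (nat \<Rightarrow> nat) \<Rightarrow> (nat \<Rightarrow> nat) \<Rightarrow> bool" where
  "is_face J k' k \<longleftrightarrow> (\<forall>i<J. k i div 2 \<le> k' i div 2 \<and> (k' i + 1) div 2 \<le> (k i + 1) div 2)"

text \<open>The smallest cell containing \<open>x\<close>: floor plus ceiling is \<open>2 * a\<close> at \<open>a\<close> and \<open>2 * a + 1\<close>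
  strictly between \<open>a\<close> and \<open>a + 1\<close>.\<close>

definition carrier :: "nat \<Rightarrow> nat \<Rightarrow> (nat \<Rightarrow> real) \<Rightarrow> nat \<Rightarrow> nat" where
  "carrier N J x = restrict (\<lambda>i. nat (\<lfloor>real N * x i\<rfloor> + \<lceil>real N * x i\<rceil>)) {..<J}"

definition subcomplex :: "nat \<Rightarrow> nat \<Rightarrow> (nat \<Rightarrow> nat) set \<Rightarrow> bool" where
  "subcomplex N J \<S> \<longleftrightarrow> \<S> \<subseteq> grid N J \<and> (\<forall>k\<in>\<S>. \<forall>k'\<in>grid N J. is_face J k' k \<longrightarrow> k' \<in> \<S>)"

text \<open>Membership is decided by the carrier and not by lying in some cell of the set. Thus
  intersections and unions of arbitrary sets of cells pass to supports, while for subcomplexes the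
  support is still the union of the cells.\<close>

definition support :: "nat \<Rightarrow> nat \<Rightarrow> (nat \<Rightarrow> nat) set \<Rightarrow> (nat \<Rightarrow> real) set" where
  "support N J \<S> = {x \<in> unit_cube J. carrier N J x \<in> \<S>}"

section \<open>Carriers and faces\<close>

lemma finite_grid: "finite (grid N J)"
  by (simp add: grid_def finite_PiE)

lemma is_face_trans: "is_face J a b \<Longrightarrow> is_face J b c \<Longrightarrow> is_face J a c"
  unfolding is_face_def by (meson le_trans)

lemma cell_mono: "is_face J k' k \<Longrightarrow> cell N J k' \<subseteq> cell N J k"
  unfolding is_face_def cell_def by (fastforce intro: order_trans simp del: of_nat_add)

lemma carrier_apply:
  assumes "x \<in> unit_cube J" "i < J"
  obtains a where "carrier N J x i = 2 * a" "real N * x i = real a"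
  | a where "carrier N J x i = 2 * a + 1" "real a < real N * x i" "real N * x i < real (a + 1)"
proof -
  define y where "y = real N * x i"
  have y: "y \<ge> 0" using assms by (auto simp: y_def PiE_iff)
  define a where "a = nat \<lfloor>y\<rfloor>"
  have fl: "\<lfloor>y\<rfloor> = int a" using y by (simp add: a_def)
  have c: "carrier N J x i = nat (\<lfloor>y\<rfloor> + \<lceil>y\<rceil>)" using assms by (simp add: carrier_def y_def)
  show ?thesis
  proof (cases "y = real a")
    case True
    then have "\<lceil>y\<rceil> = int a" by simp
    with fl c True that(1)[of a] show ?thesis by (simp add: y_def)
  next
    case False
    have "real a < y" "y < real (a + 1)" using fl False y unfolding floor_eq_iff by auto
    moreover from this have "\<lceil>y\<rceil> = int a + 1" by (auto simp: ceiling_eq_iff)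
    ultimately show ?thesis using that(2)[of a] fl c by (simp add: y_def nat_add_distrib)
  qed
qed

lemma carrier_in_grid: "x \<in> unit_cube J \<Longrightarrow> carrier N J x \<in> grid N J"
proof (unfold grid_def, rule PiE_I)
  fix i assume x: "x \<in> unit_cube J" and "i \<in> {..<J}"
  then have i: "i < J" by simp
  have le: "real N * x i \<le> real N" using x i by (auto simp: PiE_iff mult_left_le)
  show "carrier N J x i \<in> {..2 * N}"
  proof (rule carrier_apply[OF x i, of N])
    fix a assume "carrier N J x i = 2 * a" "real N * x i = real a"
    then show ?thesis using le by simp
  next
    fix a assume a: "carrier N J x i = 2 * a + 1" "real a < real N * x i"
    then have "real a < real N" using le by linarith
    then show ?thesis using a by simp
  qed
qed (simp add: carrier_def)

lemma mem_cell_carrier: "x \<in> unit_cube J \<Longrightarrow> x \<in> cell N J (carrier N J x)"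
  unfolding cell_def
proof (safe)
  fix i assume x: "x \<in> unit_cube J" and i: "i < J"
  show "real (carrier N J x i div 2) \<le> real N * x i"
    by (rule carrier_apply[OF x i, of N]) auto
  show "real N * x i \<le> real ((carrier N J x i + 1) div 2)"
    by (rule carrier_apply[OF x i, of N]) auto
qed

text \<open>Multiplied by \<open>N\<close>, the end points of a cell are integers, so bounds on
  \<open>real N * x i\<close> carry over to its floor and ceiling, which are the end points of the
  carrier.\<close>

lemma carrier_is_face: "x \<in> cell N J k \<Longrightarrow> is_face J (carrier N J x) k"
  unfolding is_face_def
proof (intro allI impI)
  fix i assume x: "x \<in> cell N J k" and i: "i < J"
  then have xc: "x \<in> unit_cube J" by (simp add: cell_def)
  have b: "real (k i div 2) \<le> real N * x i" "real N * x i \<le> real ((k i + 1) div 2)"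
    using x i by (auto simp: cell_def)
  show "k i div 2 \<le> carrier N J x i div 2 \<and> (carrier N J x i + 1) div 2 \<le> (k i + 1) div 2"
  proof (rule carrier_apply[OF xc i, of N])
    fix a assume "carrier N J x i = 2 * a" "real N * x i = real a"
    with b show ?thesis by simp
  next
    fix a assume a: "carrier N J x i = 2 * a + 1" "real a < real N * x i" "real N * x i < real (a + 1)"
    have "real (k i div 2) < real (a + 1)" "real a < real ((k i + 1) div 2)" using a b by linarith+
    then have "k i div 2 \<le> a" "a + 1 \<le> (k i + 1) div 2" by (simp_all only: of_nat_less_iff)
    with a show ?thesis by simp
  qed
qed

text \<open>An odd index stands for an interval of unit length, and no interval of the grid is
  longer, so an interval containing it equals it. Dually, in \<open>half_squeeze_even\<close>, a
  point contains nothing but itself.\<close>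

lemma half_squeeze_odd:
  fixes k m :: nat
  assumes "m div 2 \<le> k div 2" "(k + 1) div 2 \<le> (m + 1) div 2" "odd k"
  shows "k = m"
proof -
  obtain a where a: "k = 2 * a + 1" using assms(3) by (elim oddE)
  have "m div 2 \<le> a" "a + 1 \<le> (m + 1) div 2" using assms(1,2) a by auto
  then show ?thesis using a by linarith
qed

lemma half_squeeze_even:
  fixes k m :: nat
  assumes "m div 2 \<le> k div 2" "(k + 1) div 2 \<le> (m + 1) div 2" "even m"
  shows "k = m"
proof -
  obtain a where a: "m = 2 * a" using assms(3) by (elim evenE)
  have "a \<le> k div 2" "(k + 1) div 2 \<le> a" using assms(1,2) a by auto
  then show ?thesis using a by linarith
qed

lemma is_face_odd:
  assumes "is_face J k' k" "i < J" "odd (k' i)"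
  shows "k' i = k i"
  using assms by (intro half_squeeze_odd) (auto simp: is_face_def)

lemma is_face_even:
  assumes "is_face J k' k" "i < J" "even (k i)"
  shows "k' i = k i"
  using assms by (intro half_squeeze_even) (auto simp: is_face_def)

text \<open>The interval directions of a face are among those of the cell; if there are not fewer,
  they coincide, and then all entries do. So proper faces have strictly smaller dimension, which
  allows adding cells in order of dimension.\<close>

lemma is_face_antisym:
  assumes "is_face J k' k" "k \<in> grid N J" "k' \<in> grid N J" "cell_dim J k \<le> cell_dim J k'"
  shows "k' = k"
proof -
  have sub: "{i. i < J \<and> odd (k' i)} \<subseteq> {i. i < J \<and> odd (k i)}"
    using is_face_odd[OF assms(1)] by force
  then have "{i. i < J \<and> odd (k' i)} = {i. i < J \<and> odd (k i)}"
    using assms(4) unfolding cell_dim_def by (intro card_seteq) auto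
  then have "k' i = k i" if "i < J" for i
    using is_face_odd[OF assms(1) that] is_face_even[OF assms(1) that] that by blast
  then show ?thesis using assms(2,3) unfolding grid_def by (intro PiE_ext) auto
qed

section \<open>Closedness of cells and supports\<close>

lemma compact_unit_cube: "compact (unit_cube J)"
proof -
  have "compact_space (cube J)"
    unfolding cube_def by (simp add: compact_space_product_topology compact_space_subtopology)
  then show ?thesis
    unfolding cube_eq using compactin_subspace[of euclidean "unit_cube J"] by simp
qed

lemma closed_unit_cube: "closed (unit_cube J)"
  by (rule compact_imp_closed[OF compact_unit_cube])

lemma closed_cell: "closed (cell N J k)"
proof -
  have "cell N J k = unit_cube J \<inter> (\<Inter>i\<in>{..<J}. {x. x i \<in> {y. real (k i div 2) \<le> real N * y} \<inter> {y. real N * y \<le> real ((k i + 1) div 2)}})"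
    by (auto simp: cell_def)
  moreover have "closed {x :: nat \<Rightarrow> real. x i \<in> {y. real (k i div 2) \<le> real N * y} \<inter> {y. real N * y \<le> real ((k i + 1) div 2)}}" for i
    using continuous_closed_preimage[OF continuous_on_apply[of UNIV i], of "{y. real (k i div 2) \<le> real N * y} \<inter> {y. real N * y \<le> real ((k i + 1) div 2)}"]
    by (simp add: vimage_def closed_Collect_le closed_Int continuous_on_mult)
  ultimately show ?thesis by (simp add: closed_Int closed_INT closed_unit_cube)
qed

lemma support_eq_cells:
  assumes "subcomplex N J \<S>"
  shows "support N J \<S> = (\<Union>k\<in>\<S>. cell N J k)"
proof
  show "support N J \<S> \<subseteq> (\<Union>k\<in>\<S>. cell N J k)"
    using mem_cell_carrier by (auto simp: support_def)
  show "(\<Union>k\<in>\<S>. cell N J k) \<subseteq> support N J \<S>"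
  proof
    fix x assume "x \<in> (\<Union>k\<in>\<S>. cell N J k)"
    then obtain k where k: "k \<in> \<S>" "x \<in> cell N J k" by blast
    then have "x \<in> unit_cube J" by (simp add: cell_def)
    with k carrier_is_face[OF k(2)] carrier_in_grid assms show "x \<in> support N J \<S>"
      by (auto simp: support_def subcomplex_def)
  qed
qed

lemma closed_support:
  assumes "subcomplex N J \<S>"
  shows "closed (support N J \<S>)"
proof -
  have "finite \<S>" using assms finite_subset[OF _ finite_grid] by (auto simp: subcomplex_def)
  then show ?thesis
    by (simp add: support_eq_cells[OF assms] closed_cell closed_UN)
qed

lemma subcomplex_Int: "subcomplex N J \<S> \<Longrightarrow> subcomplex N J \<T> \<Longrightarrow> subcomplex N J (\<S> \<inter> \<T>)"
  unfolding subcomplex_def by blast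

lemma subcomplex_Un: "subcomplex N J \<S> \<Longrightarrow> subcomplex N J \<T> \<Longrightarrow> subcomplex N J (\<S> \<union> \<T>)"
  unfolding subcomplex_def by blast

lemma support_Int: "support N J (\<S> \<inter> \<T>) = support N J \<S> \<inter> support N J \<T>"
  by (auto simp: support_def)

lemma support_Un: "support N J (\<S> \<union> \<T>) = support N J \<S> \<union> support N J \<T>"
  by (auto simp: support_def)

text \<open>The relative boundary, expressed by carriers: such a point has a proper face as its
  carrier, so the frontier lies in the support of every set of cells that contains the proper
  faces.\<close>

definition cell_frontier :: "nat \<Rightarrow> nat \<Rightarrow> (nat \<Rightarrow> nat) \<Rightarrow> (nat \<Rightarrow> real) set" where
  "cell_frontier N J k = {x \<in> cell N J k. carrier N J x \<noteq> k}"

text \<open>An affine change of coordinates identifies the cell with the unit cube of dimension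
  \<open>cell_dim J k\<close> and its frontier with the boundary, so a single filling in that
  dimension suffices.\<close>

lemma extend_over_cell:
  assumes N: "N > 0" and "fills q Y" and k: "k \<in> grid N J" "cell_dim J k < q"
    and f: "continuous_on (cell_frontier N J k) f" "f \<in> cell_frontier N J k \<rightarrow> Y"
  obtains g where "continuous_on (cell N J k) g" "g \<in> cell N J k \<rightarrow> Y"
    "\<And>x. x \<in> cell_frontier N J k \<Longrightarrow> g x = f x"
proof -
  define d where "d = cell_dim J k"
  define F where "F = {i. i < J \<and> odd (k i)}"
  have "finite F" by (simp add: F_def)
  then obtain \<sigma> where \<sigma>: "bij_betw \<sigma> {..<d} F"
    using ex_bij_betw_nat_finite[of F] unfolding d_def cell_dim_def F_def atLeast0LessThan by blast
  define \<tau> where "\<tau> = the_inv_into {..<d} \<sigma>"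
  have \<tau>: "\<tau> i < d" "\<sigma> (\<tau> i) = i" if "i \<in> F" for i
    using bij_betw_apply[OF bij_betw_the_inv_into[OF \<sigma>] that] f_the_inv_into_f_bij_betw[OF \<sigma>] that
    by (auto simp: \<tau>_def)
  have \<sigma>F: "\<sigma> t \<in> F" if "t < d" for t using \<sigma> that by (auto simp: bij_betw_def)
  have \<tau>\<sigma>: "\<tau> (\<sigma> t) = t" if "t < d" for t
    using \<sigma> that by (simp add: \<tau>_def bij_betw_def the_inv_into_f_f)
  \<comment> \<open>\<open>\<phi>\<close> places the unit cube onto the cell: coordinate
    \<open>\<tau> i\<close> runs along the interval direction \<open>i\<close>, and the even
    directions stay at their grid point. \<open>\<psi>\<close> rescales back.\<close>
  define \<phi> where "\<phi> y = restrict (\<lambda>i. if i \<in> F then (real (k i div 2) + y (\<tau> i)) / real N else real (k i div 2) / real N) {..<J}" for y :: "nat \<Rightarrow> real"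
  define \<psi> where "\<psi> x = restrict (\<lambda>t. real N * x (\<sigma> t) - real (k (\<sigma> t) div 2)) {..<d}" for x :: "nat \<Rightarrow> real"
  have contphi: "continuous_on S \<phi>" for S
  proof -
    have "continuous_on S (\<lambda>y. if i \<in> F then (real (k i div 2) + y (\<tau> i)) / real N else real (k i div 2) / real N)" for i
      using N by (cases "i \<in> F") (auto intro!: continuous_on_divide continuous_on_add continuous_on_const continuous_on_apply)
    then show ?thesis unfolding \<phi>_def[abs_def] by (intro continuous_on_restrict_fun)
  qed
  have contpsi: "continuous_on S \<psi>" for S
    unfolding \<psi>_def[abs_def]
    by (intro continuous_on_restrict_fun continuous_on_diff continuous_on_mult continuous_on_const continuous_on_apply)
  have kN: "(k i + 1) div 2 \<le> N" if "i < J" for i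
  proof -
    have "k i \<le> 2 * N" using k(1) that by (auto simp: grid_def)
    then show ?thesis by presburger
  qed
  have odd_div: "(k i + 1) div 2 = k i div 2 + 1" if "i \<in> F" for i
    using that by (auto simp: F_def elim!: oddE)
  have even_div: "(k i + 1) div 2 = k i div 2" if "i < J" "i \<notin> F" for i
    using that by (auto simp: F_def)
  have phi_cell: "\<phi> y \<in> cell N J k" if y: "y \<in> unit_cube d" for y
  proof -
    have *: "real (k i div 2) \<le> real N * \<phi> y i \<and> real N * \<phi> y i \<le> real ((k i + 1) div 2)" if "i < J" for i
      using N that even_div[OF that] odd_div[of i] y \<tau>(1)[of i]
      by (cases "i \<in> F") (auto simp: \<phi>_def PiE_iff)
    have "0 \<le> \<phi> y i \<and> \<phi> y i \<le> 1" if "i < J" for i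
    proof -
      have "real N * \<phi> y i \<le> real N" using *[OF that] kN[OF that] by linarith
      moreover have "0 \<le> real N * \<phi> y i" using *[OF that] by linarith
      ultimately show ?thesis using N by (simp add: zero_le_mult_iff)
    qed
    with * show ?thesis by (auto simp: cell_def PiE_iff) (simp add: \<phi>_def)
  qed
  have psi_cube: "\<psi> x \<in> unit_cube d" if x: "x \<in> cell N J k" for x
  proof -
    have "0 \<le> real N * x (\<sigma> t) - real (k (\<sigma> t) div 2) \<and> real N * x (\<sigma> t) - real (k (\<sigma> t) div 2) \<le> 1" if "t < d" for t
    proof -
      have "\<sigma> t < J" using \<sigma>F[OF that] by (simp add: F_def)
      then have "real (k (\<sigma> t) div 2) \<le> real N * x (\<sigma> t)" "real N * x (\<sigma> t) \<le> real ((k (\<sigma> t) + 1) div 2)"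
        using x by (auto simp: cell_def)
      then show ?thesis using odd_div[OF \<sigma>F[OF that]] by simp
    qed
    then show ?thesis by (auto simp: \<psi>_def)
  qed
  have phipsi: "\<phi> (\<psi> x) = x" if x: "x \<in> cell N J k" for x
  proof
    fix i show "\<phi> (\<psi> x) i = x i"
    proof (cases "i < J")
      case True
      then have "real (k i div 2) \<le> real N * x i" "real N * x i \<le> real ((k i + 1) div 2)"
        using x by (auto simp: cell_def)
      then show ?thesis using True N \<tau>[of i] even_div[OF True]
        by (cases "i \<in> F") (auto simp: \<phi>_def \<psi>_def field_simps)
    next
      case False
      then show ?thesis using x by (auto simp: \<phi>_def cell_def PiE_iff extensional_def)
    qed
  qed
  have phi_frontier: "\<phi> y \<in> cell_frontier N J k" if y: "y \<in> cube_boundary d" for y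
  proof -
    obtain t where t: "t < d" "y t = 0 \<or> y t = 1" using y unfolding cube_boundary_eq by blast
    define i where "i = \<sigma> t"
    have i: "i \<in> F" "\<tau> i = t" "i < J" using \<sigma>F[OF t(1)] \<tau>\<sigma>[OF t(1)] by (auto simp: i_def F_def)
    have c: "\<phi> y \<in> cell N J k" using phi_cell y by (simp add: cube_boundary_eq)
    \<comment> \<open>A coordinate 0 or 1 of \<open>y\<close> becomes a grid point in direction
      \<open>i\<close>. The carrier then has an even entry there, whereas \<open>k i\<close> is
      odd.\<close>
    have eq: "real N * \<phi> y i = real (k i div 2) \<or> real N * \<phi> y i = real (k i div 2 + 1)"
      using t(2) i N by (auto simp: \<phi>_def)
    have "carrier N J (\<phi> y) i \<noteq> k i"
    proof (rule carrier_apply[of "\<phi> y" J i N])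
      show "\<phi> y \<in> unit_cube J" using c by (simp add: cell_def)
      show "i < J" by (fact i)
      fix a assume "carrier N J (\<phi> y) i = 2 * a"
      then show ?thesis using i(1) by (metis (no_types, lifting) F_def dvd_triv_left mem_Collect_eq)
    next
      fix a assume "carrier N J (\<phi> y) i = 2 * a + 1" "real a < real N * \<phi> y i" "real N * \<phi> y i < real (a + 1)"
      then show ?thesis using eq by auto
    qed
    with c show ?thesis by (auto simp: cell_frontier_def)
  qed
  have psi_boundary: "\<psi> x \<in> cube_boundary d" if x: "x \<in> cell_frontier N J k" for x
  proof -
    have xc: "x \<in> cell N J k" and xn: "carrier N J x \<noteq> k" using x by (auto simp: cell_frontier_def)
    have xu: "x \<in> unit_cube J" using xc by (simp add: cell_def)
    \<comment> \<open>In the direction \<open>i\<close> where carrier and cell differ,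
      \<open>k i\<close> must be odd, since faces inherit even entries, and the carrier must be
      even, since an odd entry would equal \<open>k i\<close>. Hence \<open>x i\<close> is an end
      point of the interval.\<close>
    obtain i where i: "i < J" "carrier N J x i \<noteq> k i"
      using xn k(1) carrier_in_grid[OF xu, of N] unfolding grid_def by (metis PiE_ext lessThan_iff)
    have fc: "is_face J (carrier N J x) k" using carrier_is_face[OF xc] .
    have iF: "i \<in> F" using is_face_even[OF fc i(1)] i by (auto simp: F_def)
    have b: "real (k i div 2) \<le> real N * x i" "real N * x i \<le> real (k i div 2 + 1)"
      using xc i(1) odd_div[OF iF] by (auto simp: cell_def)
    have "real N * x i = real (k i div 2) \<or> real N * x i = real (k i div 2 + 1)"
    proof (rule carrier_apply[OF xu i(1), of N])
      fix a assume "carrier N J x i = 2 * a" "real N * x i = real a"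
      with b have "k i div 2 \<le> a" "a \<le> k i div 2 + 1" by (simp_all only: of_nat_le_iff)
      then have "a = k i div 2 \<or> a = k i div 2 + 1" by linarith
      then show ?thesis using \<open>real N * x i = real a\<close> by auto
    next
      fix a assume "carrier N J x i = 2 * a + 1"
      then show ?thesis using is_face_odd[OF fc i(1)] i by simp
    qed
    then have "\<psi> x (\<tau> i) = 0 \<or> \<psi> x (\<tau> i) = 1" using \<tau>[OF iF] by (auto simp: \<psi>_def)
    then show ?thesis using \<tau>(1)[OF iF] psi_cube[OF xc] unfolding cube_boundary_eq by blast
  qed
  obtain g where g: "continuous_on (unit_cube d) g" "g \<in> unit_cube d \<rightarrow> Y"
    "\<And>y. y \<in> cube_boundary d \<Longrightarrow> g y = f (\<phi> y)"
  proof (rule fillsD[OF assms(2), of d])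
    show "d < q" using k by (simp add: d_def)
    show "continuous_on (cube_boundary d) (\<lambda>y. f (\<phi> y))"
      by (rule continuous_on_compose2[OF f(1) contphi]) (use phi_frontier in auto)
    show "(\<lambda>y. f (\<phi> y)) \<in> cube_boundary d \<rightarrow> Y" using f(2) phi_frontier by auto
  qed auto
  show ?thesis
  proof
    show "continuous_on (cell N J k) (\<lambda>x. g (\<psi> x))"
      by (rule continuous_on_compose2[OF g(1) contpsi]) (use psi_cube in auto)
    show "(\<lambda>x. g (\<psi> x)) \<in> cell N J k \<rightarrow> Y" using g(2) psi_cube by auto
    show "g (\<psi> x) = f x" if "x \<in> cell_frontier N J k" for x
      using g(3)[OF psi_boundary[OF that]] phipsi that by (simp add: cell_frontier_def)
  qed
qed

lemma continuous_on_closed_glue: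
  assumes "closed A" "closed B" "continuous_on A f" "continuous_on B g"
    "\<And>x. x \<in> A \<Longrightarrow> x \<in> B \<Longrightarrow> f x = g x"
  shows "continuous_on (A \<union> B) (\<lambda>x. if x \<in> A then f x else g x)"
proof (rule continuous_on_cases_local)
  show "closedin (top_of_set (A \<union> B)) A" "closedin (top_of_set (A \<union> B)) B"
    using assms by (auto intro: closed_subset)
qed (use assms in auto)

text \<open>The missing cells are added one at a time, always one of minimal dimension among those
  missing. Its proper faces are then already present, so the map is given on the whole
  frontier.\<close>

lemma extend_over_subcomplex:
  assumes N: "N > 0" and Y: "fills q Y"
    and S: "subcomplex N J \<S>" and T: "subcomplex N J \<T>" and "\<S> \<subseteq> \<T>"
    and dim: "\<And>k. k \<in> \<T> - \<S> \<Longrightarrow> cell_dim J k < q"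
    and f: "continuous_on (support N J \<S>) f" "f \<in> support N J \<S> \<rightarrow> Y"
  obtains g where "continuous_on (support N J \<T>) g" "g \<in> support N J \<T> \<rightarrow> Y"
    "\<And>x. x \<in> support N J \<S> \<Longrightarrow> g x = f x"
proof -
  have "\<exists>g. continuous_on (support N J \<T>) g \<and> g \<in> support N J \<T> \<rightarrow> Y \<and> (\<forall>x\<in>support N J \<S>. g x = f x)"
    using S \<open>\<S> \<subseteq> \<T>\<close> dim f
  proof (induction "card (\<T> - \<S>)" arbitrary: \<S> f)
  case 0
  have "finite \<T>" using T finite_subset[OF _ finite_grid] by (auto simp: subcomplex_def)
  with 0 have "\<S> = \<T>" by auto
  with 0 show ?case by auto
next
  case (Suc n)
  note S = \<open>subcomplex N J \<S>\<close> and ST = \<open>\<S> \<subseteq> \<T>\<close>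
    and f = \<open>continuous_on (support N J \<S>) f\<close> \<open>f \<in> support N J \<S> \<rightarrow> Y\<close>
  have "finite \<T>" using T finite_subset[OF _ finite_grid] by (auto simp: subcomplex_def)
  have "\<T> - \<S> \<noteq> {}" using Suc(2) by (metis card.empty nat.distinct(1))
  then obtain k where k: "k \<in> \<T> - \<S>" and kmin: "\<And>k'. k' \<in> \<T> - \<S> \<Longrightarrow> cell_dim J k \<le> cell_dim J k'"
    using ex_min_if_finite[of "cell_dim J ` (\<T> - \<S>)"] \<open>finite \<T>\<close>
    by (metis (mono_tags, lifting) arg_min_if_finite(1) arg_min_least finite_Diff)
  have kg: "k \<in> grid N J" using k T by (auto simp: subcomplex_def)
  have faces: "k' \<in> \<S>" if "k' \<in> grid N J" "is_face J k' k" "k' \<noteq> k" for k'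
    using that k kmin[of k'] is_face_antisym[OF that(2) kg that(1)] T unfolding subcomplex_def by blast
  have S': "subcomplex N J (insert k \<S>)"
    using S kg faces unfolding subcomplex_def by blast
  have fr: "cell_frontier N J k \<subseteq> support N J \<S>"
    using faces carrier_is_face carrier_in_grid by (auto simp: cell_frontier_def support_def cell_def)
  obtain g where g: "continuous_on (cell N J k) g" "g \<in> cell N J k \<rightarrow> Y"
    "\<And>x. x \<in> cell_frontier N J k \<Longrightarrow> g x = f x"
  proof (rule extend_over_cell[OF N Y kg])
    show "cell_dim J k < q" using Suc.prems(3) k by blast
    show "continuous_on (cell_frontier N J k) f" using f(1) fr continuous_on_subset by blast
    show "f \<in> cell_frontier N J k \<rightarrow> Y" using f(2) fr by blast
  qed auto
  define h where "h x = (if x \<in> support N J \<S> then f x else g x)" for x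
  have sup: "support N J (insert k \<S>) = support N J \<S> \<union> cell N J k"
    unfolding support_eq_cells[OF S] support_eq_cells[OF S'] by auto
  have "continuous_on (support N J (insert k \<S>)) h"
    unfolding sup h_def
  proof (rule continuous_on_closed_glue[OF closed_support[OF S] closed_cell f(1) g(1)])
    fix x assume "x \<in> support N J \<S>" "x \<in> cell N J k"
    then have "x \<in> cell_frontier N J k" using k by (auto simp: cell_frontier_def support_def)
    then show "f x = g x" using g(3) by simp
  qed
  moreover have "h \<in> support N J (insert k \<S>) \<rightarrow> Y"
    using f(2) g(2) unfolding sup h_def by auto
  moreover have n: "n = card (\<T> - insert k \<S>)"
    using Suc(2) k \<open>finite \<T>\<close> by (metis Diff_insert card_Diff_singleton diff_Suc_1)
  ultimately have "\<exists>g. continuous_on (support N J \<T>) g \<and> g \<in> support N J \<T> \<rightarrow> Y \<and>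
      (\<forall>x\<in>support N J (insert k \<S>). g x = h x)"
    using ST k Suc.prems(3) by (intro Suc(1)[OF n S']) auto
  then obtain h' where h': "continuous_on (support N J \<T>) h'" "h' \<in> support N J \<T> \<rightarrow> Y"
    "\<And>x. x \<in> support N J (insert k \<S>) \<Longrightarrow> h' x = h x"
    by blast
  moreover have "h' x = f x" if "x \<in> support N J \<S>" for x
    using h'(3)[of x] that sup by (simp add: h_def)
  ultimately show ?case by blast
qed
  with that show ?thesis by blast
qed

section \<open>Gluing along an open cover\<close>

lemma closed_cube_boundary: "closed (cube_boundary J)"
proof -
  have "cube_boundary J = unit_cube J \<inter> (\<Union>i\<in>{..<J}. {x. x i \<in> {0, 1}})"
    unfolding cube_boundary_eq by blast
  moreover have "closed {x :: nat \<Rightarrow> real. x i \<in> {0, 1}}" for i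
    using continuous_closed_preimage[OF continuous_on_apply[of UNIV i], of "{0, 1 :: real}"]
    by (simp add: vimage_def)
  ultimately show ?thesis by (simp add: closed_Int closed_UN closed_unit_cube)
qed

lemma compact_cube_boundary: "compact (cube_boundary J)"
proof -
  have "cube_boundary J = unit_cube J \<inter> cube_boundary J" unfolding cube_boundary_eq by blast
  then show ?thesis using compact_Int_closed[OF compact_unit_cube closed_cube_boundary] by metis
qed

lemma tendsto_fun_iff:
  fixes f :: "'a \<Rightarrow> 'b \<Rightarrow> 'c::topological_space"
  shows "(f \<longlongrightarrow> l) F \<longleftrightarrow> (\<forall>i. ((\<lambda>n. f n i) \<longlongrightarrow> l i) F)"
  using limitin_componentwise[of "\<lambda>_::'b. euclidean :: 'c topology" UNIV f l F]
  by (simp add: euclidean_product_topology)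

text \<open>This is the Lebesgue number argument for the preimages of \<open>U\<close> and
  \<open>V\<close>. If every grid fails, some cell of the grid with \<open>Suc n\<close> pieces
  contains boundary points \<open>x n\<close> and \<open>y n\<close> mapped outside \<open>U\<close>
  and outside \<open>V\<close>. They differ by at most \<open>1 / Suc n\<close> in each of the
  \<open>J\<close> directions and agree in all others, where points of the cube are
  \<open>undefined\<close>. A subsequence makes both converge to the same \<open>l\<close>, and
  \<open>f l\<close> lies in one of the two relatively open sets.\<close>

lemma fine_grid:
  fixes f :: "(nat \<Rightarrow> real) \<Rightarrow> 'a::topological_space"
  assumes U: "openin (top_of_set Y) U" and V: "openin (top_of_set Y) V" and Y: "Y \<subseteq> U \<union> V"
    and f: "continuous_on (cube_boundary J) f" "f \<in> cube_boundary J \<rightarrow> Y"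
  obtains N where "N > 0" "\<And>k. k \<in> grid N J \<Longrightarrow> f ` (cell N J k \<inter> cube_boundary J) \<subseteq> U \<or> f ` (cell N J k \<inter> cube_boundary J) \<subseteq> V"
proof (rule ccontr)
  note witness = that
  assume "\<not> thesis"
  then have "\<exists>k. \<not> f ` (cell N J k \<inter> cube_boundary J) \<subseteq> U \<and> \<not> f ` (cell N J k \<inter> cube_boundary J) \<subseteq> V" if N: "N > 0" for N
    using witness[OF N] by blast
  then have "\<exists>k x y. x \<in> cell (Suc n) J k \<inter> cube_boundary J \<and> y \<in> cell (Suc n) J k \<inter> cube_boundary J \<and> f x \<notin> U \<and> f y \<notin> V" for n
    by (meson image_subsetI zero_less_Suc)
  then obtain k x y where
    xy: "\<And>n. x n \<in> cell (Suc n) J (k n)" "\<And>n. x n \<in> cube_boundary J"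
      "\<And>n. y n \<in> cell (Suc n) J (k n)" "\<And>n. y n \<in> cube_boundary J"
      "\<And>n. f (x n) \<notin> U" "\<And>n. f (y n) \<notin> V"
    by (metis IntE)
  obtain l r where l: "l \<in> cube_boundary J" and r: "strict_mono (r :: nat \<Rightarrow> nat)" and lim: "(x \<circ> r) \<longlonglongrightarrow> l"
    using compact_imp_seq_compact[OF compact_cube_boundary[of J]] xy(2) unfolding seq_compact_def by metis
  have diff: "\<bar>y n i - x n i\<bar> \<le> 1 / real (Suc n)" if i: "i < J" for n i
  proof -
    have "real (k n i div 2) \<le> real (Suc n) * x n i" "real (Suc n) * x n i \<le> real ((k n i + 1) div 2)"
      "real (k n i div 2) \<le> real (Suc n) * y n i" "real (Suc n) * y n i \<le> real ((k n i + 1) div 2)"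
      using xy(1)[of n] xy(3)[of n] i unfolding cell_def by blast+
    moreover have "(k n i + 1) div 2 \<le> k n i div 2 + 1" by linarith
    then have "real ((k n i + 1) div 2) \<le> real (k n i div 2) + 1" by linarith
    ultimately have "\<bar>real (Suc n) * y n i - real (Suc n) * x n i\<bar> \<le> 1" by linarith
    then have "real (Suc n) * \<bar>y n i - x n i\<bar> \<le> 1"
      by (metis abs_mult abs_of_nat right_diff_distrib)
    then show ?thesis by (simp add: field_simps)
  qed
  have "(\<lambda>n. (y \<circ> r) n i) \<longlonglongrightarrow> l i" for i
  proof (cases "i < J")
    case True
    have x: "(\<lambda>n. (x \<circ> r) n i) \<longlonglongrightarrow> l i" using lim by (simp add: tendsto_fun_iff)
    have "(\<lambda>n. y n i - x n i) \<longlonglongrightarrow> 0"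
    proof (rule tendsto_rabs_zero_cancel, rule tendsto_sandwich[OF _ _ tendsto_const LIMSEQ_inverse_real_of_nat])
      show "\<forall>\<^sub>F n in sequentially. \<bar>y n i - x n i\<bar> \<le> inverse (real (Suc n))"
        using diff[OF True] by (simp add: inverse_eq_divide)
    qed simp
    then have "(\<lambda>n. y (r n) i - x (r n) i) \<longlonglongrightarrow> 0"
      using LIMSEQ_subseq_LIMSEQ[OF _ r] by (force simp: o_def)
    from tendsto_add[OF this x] show ?thesis by simp
  next
    case False
    have "z i = undefined" if "z \<in> cube_boundary J" for z :: "nat \<Rightarrow> real"
      using that False unfolding cube_boundary_eq by (auto simp: PiE_iff extensional_def)
    then have "(y \<circ> r) n i = l i" for n using xy(4)[of "r n"] l by (metis comp_apply)
    then show ?thesis by simp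
  qed
  then have lim': "(y \<circ> r) \<longlonglongrightarrow> l" by (simp add: tendsto_fun_iff)
  have absurd: False
    if W: "openin (top_of_set Y) W" and "f l \<in> W" and z: "z \<longlonglongrightarrow> l" "\<And>n. z n \<in> cube_boundary J" "\<And>n. f (z n) \<notin> W" for W and z :: "nat \<Rightarrow> nat \<Rightarrow> real"
  proof -
    obtain T where T: "open T" "W = Y \<inter> T" using W by (auto simp: openin_open)
    have "(\<lambda>n. f (z n)) \<longlonglongrightarrow> f l"
      using continuous_on_tendsto_compose[OF f(1) z(1) l] z(2) by simp
    then have "\<forall>\<^sub>F n in sequentially. f (z n) \<in> T"
      using T \<open>f l \<in> W\<close> by (auto dest: topological_tendstoD)
    then obtain n where "f (z n) \<in> T" using eventually_happens' sequentially_bot by blast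
    with z(2,3)[of n] T f(2) show False by auto
  qed
  have "f l \<in> U \<or> f l \<in> V" using l f(2) Y by auto
  then show False
    using absurd[OF U _ lim] absurd[OF V _ lim'] xy by auto
qed

section \<open>Boundary cells, top cells and closures\<close>

definition boundary_cells :: "nat \<Rightarrow> nat \<Rightarrow> (nat \<Rightarrow> nat) set" where
  "boundary_cells N J = {k \<in> grid N J. \<exists>i<J. k i = 0 \<or> k i = 2 * N}"

text \<open>The entries 0 and \<open>2 * N\<close> stand for the coordinates 0 and 1; being even,
  they are inherited by faces.\<close>

lemma subcomplex_boundary_cells: "subcomplex N J (boundary_cells N J)"
proof -
  have "k' \<in> boundary_cells N J" if k: "k \<in> boundary_cells N J" "k' \<in> grid N J" "is_face J k' k" for k k'
  proof -
    obtain i where i: "i < J" "k i = 0 \<or> k i = 2 * N" using k(1) unfolding boundary_cells_def by blast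
    then have "k' i = k i" using is_face_even[OF k(3) i(1)] by auto
    with i k(2) show ?thesis by (auto simp: boundary_cells_def)
  qed
  then show ?thesis by (auto simp: subcomplex_def boundary_cells_def)
qed

lemma support_boundary_cells:
  assumes "N > 0"
  shows "support N J (boundary_cells N J) = cube_boundary J"
proof -
  have "(carrier N J x i = 0 \<longleftrightarrow> x i = 0) \<and> (carrier N J x i = 2 * N \<longleftrightarrow> x i = 1)"
    if "x \<in> unit_cube J" "i < J" for x i
  proof (rule carrier_apply[OF that, of N])
    fix a assume a: "carrier N J x i = 2 * a" "real N * x i = real a"
    then have x: "x i = real a / real N" using assms by (simp add: field_simps)
    show ?thesis using assms unfolding a(1) x by auto
  next
    fix a assume a: "carrier N J x i = 2 * a + 1" "real a < real N * x i" "real N * x i < real (a + 1)"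
    then have "x i \<noteq> 0" by auto
    moreover have "x i \<noteq> 1" using a(2,3) by (auto simp del: of_nat_add)
    moreover have "2 * a + 1 \<noteq> 2 * N" by presburger
    ultimately show ?thesis unfolding a(1) by simp
  qed
  then show ?thesis
    using carrier_in_grid unfolding support_def boundary_cells_def cube_boundary_eq by blast
qed

definition top_cells :: "nat \<Rightarrow> nat \<Rightarrow> (nat \<Rightarrow> nat) set" where
  "top_cells N J = {k \<in> grid N J. \<forall>i<J. odd (k i)}"

definition closure_cells :: "nat \<Rightarrow> nat \<Rightarrow> (nat \<Rightarrow> nat) set \<Rightarrow> (nat \<Rightarrow> nat) set" where
  "closure_cells N J \<T> = {k \<in> grid N J. \<exists>t\<in>\<T>. is_face J k t}"

lemma subcomplex_closure_cells: "subcomplex N J (closure_cells N J \<T>)"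
  unfolding subcomplex_def closure_cells_def using is_face_trans by blast

lemma grid_face_of_top_cell:
  assumes "N > 0" "k \<in> grid N J"
  obtains t where "t \<in> top_cells N J" "is_face J k t"
proof
  \<comment> \<open>Each point direction is thickened to an adjacent interval, to the right except
    at the last grid point, where only the left one exists.\<close>
  define t where "t = restrict (\<lambda>i. if odd (k i) then k i else if k i = 2 * N then k i - 1 else k i + 1) {..<J}"
  have k: "k i \<le> 2 * N" if "i < J" for i using assms(2) that by (auto simp: grid_def)
  have "t i \<le> 2 * N \<and> odd (t i)" if "i < J" for i
  proof (cases "odd (k i)")
    case False
    then show ?thesis using k[OF that] that assms(1)
      by (cases "k i = 2 * N") (auto simp: t_def Suc_le_eq)
  qed (use k[OF that] that in \<open>simp add: t_def\<close>)
  moreover have "t \<in> extensional {..<J}" by (simp add: t_def)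
  ultimately show "t \<in> top_cells N J" by (auto simp: top_cells_def grid_def PiE_iff)
  have "t i div 2 \<le> k i div 2 \<and> (k i + 1) div 2 \<le> (t i + 1) div 2" if "i < J" for i
  proof (cases "odd (k i)")
    case False
    then obtain a where a: "k i = 2 * a" by (auto elim: evenE)
    have "2 * a - 1 = 2 * (a - 1) + 1 \<or> a = 0" by linarith
    then show ?thesis using a k[OF that] that assms(1)
      by (cases "a = N") (auto simp: t_def)
  qed (use that in \<open>simp add: t_def\<close>)
  then show "is_face J k t" by (simp add: is_face_def)
qed

lemma cell_dim_le: "cell_dim J k \<le> J"
  unfolding cell_dim_def using card_mono[of "{..<J}" "{i. i < J \<and> odd (k i)}"] by auto

lemma cell_dim_eq:
  assumes "cell_dim J k = J" "i < J"
  shows "odd (k i)"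
proof -
  have "{i. i < J \<and> odd (k i)} = {..<J}"
    using assms unfolding cell_dim_def by (intro card_seteq) auto
  then show ?thesis using assms(2) by blast
qed

text \<open>The index drops by one for \<open>U \<inter> V\<close> because a cell shared by the two
  families has dimension less than \<open>J \<le> q - 1\<close>. The cells of one family have
  dimension at most \<open>J < q\<close>, which is what \<open>fills q\<close> on \<open>U\<close>
  and on \<open>V\<close> handles.\<close>

lemma fills_open_cover:
  fixes Y :: "'a::topological_space set"
  assumes U: "openin (top_of_set Y) U" and V: "openin (top_of_set Y) V" and Y: "Y = U \<union> V"
    and fU: "fills q U" and fV: "fills q V" and fUV: "fills (q - 1) (U \<inter> V)"
  shows "fills q Y"
  unfolding fills_def
proof (intro allI impI, elim conjE)
  fix J f assume J: "J < q" and f: "continuous_on (cube_boundary J) f" "f \<in> cube_boundary J \<rightarrow> Y"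
  have "Y \<subseteq> U \<union> V" using Y by simp
  then obtain N where N: "N > 0" and
    lab: "\<And>k. k \<in> grid N J \<Longrightarrow> f ` (cell N J k \<inter> cube_boundary J) \<subseteq> U \<or> f ` (cell N J k \<inter> cube_boundary J) \<subseteq> V"
    using fine_grid[OF U V _ f] by blast
  define D where "D = boundary_cells N J"
  \<comment> \<open>A top cell that admits both labels is put into \<open>T1\<close>. As
    \<open>T2\<close> is the complement, no top cell carries both labels, and this is what bounds
    the dimension of shared cells in \<open>dim12\<close>.\<close>
  define T1 where "T1 = {t \<in> top_cells N J. f ` (cell N J t \<inter> cube_boundary J) \<subseteq> U}"
  define T2 where "T2 = top_cells N J - T1"
  define C1 where "C1 = closure_cells N J T1"
  define C2 where "C2 = closure_cells N J T2"
  have sD: "subcomplex N J D" and sC1: "subcomplex N J C1" and sC2: "subcomplex N J C2"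
    by (simp_all add: D_def C1_def C2_def subcomplex_boundary_cells subcomplex_closure_cells)
  have D: "support N J D = cube_boundary J" by (simp add: D_def support_boundary_cells N)
  have f1: "f x \<in> U" if x: "x \<in> cube_boundary J" "x \<in> support N J C1" for x
  proof -
    obtain t where "t \<in> T1" "is_face J (carrier N J x) t" and xu: "x \<in> unit_cube J"
      using x(2) by (auto simp: support_def C1_def closure_cells_def)
    then have "x \<in> cell N J t" using cell_mono mem_cell_carrier by blast
    with \<open>t \<in> T1\<close> x show ?thesis by (auto simp: T1_def)
  qed
  have f2: "f x \<in> V" if x: "x \<in> cube_boundary J" "x \<in> support N J C2" for x
  proof -
    obtain t where t: "t \<in> T2" "is_face J (carrier N J x) t" and xu: "x \<in> unit_cube J"
      using x(2) by (auto simp: support_def C2_def closure_cells_def)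
    then have "x \<in> cell N J t" using cell_mono mem_cell_carrier by blast
    moreover have "f ` (cell N J t \<inter> cube_boundary J) \<subseteq> V"
      using lab[of t] t(1) by (auto simp: T1_def T2_def top_cells_def)
    ultimately show ?thesis using x by auto
  qed
  have cover: "C1 \<union> C2 = grid N J"
  proof
    show "C1 \<union> C2 \<subseteq> grid N J" by (auto simp: C1_def C2_def closure_cells_def)
    show "grid N J \<subseteq> C1 \<union> C2"
      using grid_face_of_top_cell[OF N] unfolding C1_def C2_def closure_cells_def T2_def by blast
  qed
  have dim12: "cell_dim J k < J" if k: "k \<in> C1 \<inter> C2" for k
  proof (rule ccontr)
    assume "\<not> cell_dim J k < J"
    then have odd: "odd (k i)" if "i < J" for i using cell_dim_eq[of J k i] cell_dim_le[of J k] that by simp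
    obtain t1 t2 where t: "t1 \<in> T1" "is_face J k t1" "t2 \<in> T2" "is_face J k t2"
      using k by (auto simp: C1_def C2_def closure_cells_def)
    then have "t1 i = t2 i" if "i < J" for i
      using is_face_odd[OF t(2) that] is_face_odd[OF t(4) that] odd[OF that] by simp
    moreover have "t1 \<in> grid N J" "t2 \<in> grid N J" using t by (auto simp: T1_def T2_def top_cells_def)
    ultimately have "t1 = t2" unfolding grid_def by (intro PiE_ext) auto
    with t show False by (simp add: T2_def)
  qed
  \<comment> \<open>On the part of the boundary lying in both families \<open>f\<close> already
    takes values in \<open>U \<inter> V\<close>, by \<open>f1\<close> and \<open>f2\<close>. It is
    prescribed there, and only shared cells of dimension below \<open>q - 1\<close> remain.\<close>
  obtain g where g: "continuous_on (support N J (C1 \<inter> C2)) g" "g \<in> support N J (C1 \<inter> C2) \<rightarrow> U \<inter> V"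
    "\<And>x. x \<in> support N J (D \<inter> (C1 \<inter> C2)) \<Longrightarrow> g x = f x"
  proof (rule extend_over_subcomplex[OF N fUV subcomplex_Int[OF sD subcomplex_Int[OF sC1 sC2]]
        subcomplex_Int[OF sC1 sC2]])
    show "cell_dim J k < q - 1" if "k \<in> C1 \<inter> C2 - D \<inter> (C1 \<inter> C2)" for k
      using dim12[of k] that J by auto
    show "continuous_on (support N J (D \<inter> (C1 \<inter> C2))) f"
      by (rule continuous_on_subset[OF f(1)]) (simp add: support_Int D)
    show "f \<in> support N J (D \<inter> (C1 \<inter> C2)) \<rightarrow> U \<inter> V"
      using f1 f2 by (auto simp: support_Int D)
  qed auto
  \<comment> \<open>The second stage, stated once for both families: \<open>f\<close> on the
    boundary part and \<open>g\<close> on the shared cells agree where both are defined, and the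
    glued map \<open>e\<close> is extended over all of \<open>C\<close>.\<close>
  have ext: "\<exists>h. continuous_on (support N J C) h \<and> h \<in> support N J C \<rightarrow> W \<and>
      (\<forall>x\<in>support N J (C1 \<inter> C2). h x = g x) \<and> (\<forall>x\<in>support N J C \<inter> cube_boundary J. h x = f x)"
    if C: "subcomplex N J C" "C1 \<inter> C2 \<subseteq> C" and W: "fills q W" "U \<inter> V \<subseteq> W"
      and fW: "\<And>x. x \<in> cube_boundary J \<Longrightarrow> x \<in> support N J C \<Longrightarrow> f x \<in> W" for C W
  proof -
    define e where "e x = (if x \<in> support N J (D \<inter> C) then f x else g x)" for x
    have sDC: "subcomplex N J (D \<inter> C)" and s12: "subcomplex N J (C1 \<inter> C2)"
      using subcomplex_Int sD C sC1 sC2 by blast+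
    have ce: "continuous_on (support N J (D \<inter> C \<union> C1 \<inter> C2)) e"
      unfolding support_Un[of _ _ _ "C1 \<inter> C2"] e_def
    proof (rule continuous_on_closed_glue[OF closed_support[OF sDC] closed_support[OF s12] _ g(1)])
      show "continuous_on (support N J (D \<inter> C)) f"
        by (rule continuous_on_subset[OF f(1)]) (simp add: support_Int D)
      show "f x = g x" if "x \<in> support N J (D \<inter> C)" "x \<in> support N J (C1 \<inter> C2)" for x
        using g(3)[of x] that by (simp add: support_Int)
    qed
    have eW: "e \<in> support N J (D \<inter> C \<union> C1 \<inter> C2) \<rightarrow> W"
      using g(2) fW W(2) by (auto simp: e_def support_Un support_Int D)
    obtain h where h: "continuous_on (support N J C) h" "h \<in> support N J C \<rightarrow> W"
      "\<And>x. x \<in> support N J (D \<inter> C \<union> C1 \<inter> C2) \<Longrightarrow> h x = e x"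
    proof (rule extend_over_subcomplex[OF N W(1) subcomplex_Un[OF sDC s12] C(1) _ _ ce eW])
      show "D \<inter> C \<union> C1 \<inter> C2 \<subseteq> C" using C(2) by blast
      show "cell_dim J k < q" for k using cell_dim_le[of J k] J by simp
    qed auto
    have "h x = g x" if "x \<in> support N J (C1 \<inter> C2)" for x
    proof -
      have "h x = e x" using h(3) that by (simp add: support_Un)
      also have "\<dots> = g x" using g(3)[of x] that by (auto simp: e_def support_Int)
      finally show ?thesis .
    qed
    moreover have "h x = f x" if "x \<in> support N J C" "x \<in> cube_boundary J" for x
      using h(3)[of x] that by (simp add: e_def support_Un support_Int D)
    ultimately show ?thesis using h(1,2) by blast
  qed
  obtain h1 where h1: "continuous_on (support N J C1) h1" "h1 \<in> support N J C1 \<rightarrow> U"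
    "\<And>x. x \<in> support N J (C1 \<inter> C2) \<Longrightarrow> h1 x = g x"
    "\<And>x. x \<in> support N J C1 \<Longrightarrow> x \<in> cube_boundary J \<Longrightarrow> h1 x = f x"
    using ext[OF sC1 _ fU] f1 by auto
  obtain h2 where h2: "continuous_on (support N J C2) h2" "h2 \<in> support N J C2 \<rightarrow> V"
    "\<And>x. x \<in> support N J (C1 \<inter> C2) \<Longrightarrow> h2 x = g x"
    "\<And>x. x \<in> support N J C2 \<Longrightarrow> x \<in> cube_boundary J \<Longrightarrow> h2 x = f x"
    using ext[OF sC2 _ fV] f2 by auto
  define h where "h x = (if x \<in> support N J C1 then h1 x else h2 x)" for x
  have cube: "unit_cube J = support N J C1 \<union> support N J C2"
    unfolding support_Un[symmetric] cover using carrier_in_grid by (auto simp: support_def)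
  have "continuous_on (unit_cube J) h"
    unfolding cube h_def
    by (rule continuous_on_closed_glue[OF closed_support[OF sC1] closed_support[OF sC2] h1(1) h2(1)])
      (use h1(3) h2(3) in \<open>simp add: support_Int\<close>)
  moreover have "h \<in> unit_cube J \<rightarrow> Y"
    unfolding cube using h1(2) h2(2) Y by (auto simp: h_def Pi_iff)
  moreover have "h x = f x" if "x \<in> cube_boundary J" for x
  proof -
    have "x \<in> support N J C1 \<or> x \<in> support N J C2" using that cube unfolding cube_boundary_eq by blast
    then show ?thesis using h1(4) h2(4) that by (auto simp: h_def)
  qed
  ultimately show "\<exists>g. continuous_on (unit_cube J) g \<and> g \<in> unit_cube J \<rightarrow> Y \<and> (\<forall>x\<in>cube_boundary J. g x = f x)"
    by blast
qed

section \<open>Deletions and links in simplicial complexes\<close>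

definition simplicial :: "'v set set \<Rightarrow> bool" where
  "simplicial K \<longleftrightarrow> (\<forall>\<sigma>\<in>K. finite \<sigma> \<and> \<sigma> \<noteq> {} \<and> (\<forall>\<tau>\<subseteq>\<sigma>. \<tau> \<noteq> {} \<longrightarrow> \<tau> \<in> K))"

lemma simplicialD:
  assumes "simplicial K" "\<sigma> \<in> K"
  shows "finite \<sigma>" "\<sigma> \<noteq> {}" "\<And>\<tau>. \<tau> \<subseteq> \<sigma> \<Longrightarrow> \<tau> \<noteq> {} \<Longrightarrow> \<tau> \<in> K"
proof -
  have *: "finite \<sigma> \<and> \<sigma> \<noteq> {} \<and> (\<forall>\<tau>\<subseteq>\<sigma>. \<tau> \<noteq> {} \<longrightarrow> \<tau> \<in> K)"
    by (rule bspec[OF assms(1)[unfolded simplicial_def] assms(2)])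
  then show "finite \<sigma>" "\<sigma> \<noteq> {}" by simp_all
  fix \<tau> assume "\<tau> \<subseteq> \<sigma>" "\<tau> \<noteq> {}"
  with * show "\<tau> \<in> K" by simp
qed

lemma simplicialI:
  assumes "\<And>\<sigma>. \<sigma> \<in> K \<Longrightarrow> finite \<sigma>" "{} \<notin> K"
    and "\<And>\<sigma> \<tau>. \<sigma> \<in> K \<Longrightarrow> \<tau> \<subseteq> \<sigma> \<Longrightarrow> \<tau> \<noteq> {} \<Longrightarrow> \<tau> \<in> K"
  shows "simplicial K"
  unfolding simplicial_def
proof (intro ballI conjI allI impI)
  fix \<sigma> assume \<sigma>: "\<sigma> \<in> K"
  show "finite \<sigma>" using assms(1)[OF \<sigma>] .
  show "\<sigma> \<noteq> {}" using assms(2) \<sigma> by metis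
  show "\<tau> \<in> K" if "\<tau> \<subseteq> \<sigma>" "\<tau> \<noteq> {}" for \<tau> using assms(3)[OF \<sigma> that] .
qed

definition deletion :: "'v set set \<Rightarrow> 'v \<Rightarrow> 'v set set" where
  "deletion K v = {\<sigma>\<in>K. v \<notin> \<sigma>}"

definition link :: "'v set set \<Rightarrow> 'v \<Rightarrow> 'v set set" where
  "link K v = {\<sigma>. v \<notin> \<sigma> \<and> \<sigma> \<noteq> {} \<and> insert v \<sigma> \<in> K}"

lemma simplicial_deletion:
  assumes "simplicial K"
  shows "simplicial (deletion K v)"
  by (rule simplicialI) (auto simp: deletion_def dest: simplicialD[OF assms])

lemma simplicial_link:
  assumes "simplicial K"
  shows "simplicial (link K v)"
proof (rule simplicialI)
  fix \<sigma> assume "\<sigma> \<in> link K v"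
  then have \<sigma>: "v \<notin> \<sigma>" "insert v \<sigma> \<in> K" by (auto simp: link_def)
  show "finite \<sigma>" using simplicialD(1)[OF assms \<sigma>(2)] by simp
  fix \<tau> assume \<tau>: "\<tau> \<subseteq> \<sigma>" "\<tau> \<noteq> {}"
  have "insert v \<tau> \<in> K" by (rule simplicialD(3)[OF assms \<sigma>(2)]) (use \<tau> in auto)
  then show "\<tau> \<in> link K v" using \<tau> \<sigma>(1) by (auto simp: link_def)
qed (simp add: link_def)

text \<open>The set \<open>\<sigma>\<close> may exceed the support of \<open>a\<close>, which is
  then a nonempty face of it. This allows points with different supports to be treated inside one
  simplex.\<close>

lemma realizationI:
  assumes "simplicial K" "\<sigma> \<in> K" "\<And>v. 0 \<le> a v" "\<And>v. v \<notin> \<sigma> \<Longrightarrow> a v = 0" "sum a \<sigma> = 1"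
  shows "a \<in> realization_points K"
proof -
  have fin: "finite \<sigma>" by (rule simplicialD(1)[OF assms(1,2)])
  have sub: "{v. a v \<noteq> 0} \<subseteq> \<sigma>" using assms(4) by auto
  have s: "sum a {v. a v \<noteq> 0} = 1"
    using sum.mono_neutral_left[OF fin sub, of a] assms(5) by auto
  then have "{v. a v \<noteq> 0} \<noteq> {}" by force
  then have "{v. a v \<noteq> 0} \<in> K" using simplicialD(3)[OF assms(1,2) sub] by blast
  with s assms(3) show ?thesis by (simp add: realization_points_def)
qed

lemma realizationE:
  assumes "simplicial K" "a \<in> realization_points K"
  obtains \<sigma> where "\<sigma> \<in> K" "finite \<sigma>" "\<And>v. 0 \<le> a v" "\<And>v. v \<in> \<sigma> \<longleftrightarrow> a v \<noteq> 0" "sum a \<sigma> = 1"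
  using that[of "{v. a v \<noteq> 0}"] assms(2) simplicialD(1)[OF assms(1)] by (auto simp: realization_points_def)

lemma realization_segment:
  assumes "simplicial K" "\<sigma> \<in> K" "0 \<le> t" "t \<le> 1"
    and a: "\<And>v. 0 \<le> a v" "\<And>v. v \<notin> \<sigma> \<Longrightarrow> a v = 0" "sum a \<sigma> = 1"
    and b: "\<And>v. 0 \<le> b v" "\<And>v. v \<notin> \<sigma> \<Longrightarrow> b v = 0" "sum b \<sigma> = 1"
  shows "(\<lambda>v. (1 - t) * a v + t * b v) \<in> realization_points K"
proof (rule realizationI[OF assms(1,2)])
  show "(\<Sum>v\<in>\<sigma>. (1 - t) * a v + t * b v) = 1"
    using a(3) b(3) by (simp add: sum.distrib flip: sum_distrib_left)
qed (use assms in auto)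

text \<open>The realization is star-shaped about the vertex \<open>v\<close>: a segment from a point
  with support \<open>\<sigma>\<close> to \<open>v\<close> stays in the simplex
  \<open>insert v \<sigma>\<close>.\<close>

lemma fills_cone:
  assumes K: "simplicial K" and v: "{v} \<in> K" and cone: "\<And>\<sigma>. \<sigma> \<in> K \<Longrightarrow> insert v \<sigma> \<in> K"
  shows "fills q (realization_points K)"
proof (rule fills_star_shaped[of "\<lambda>w. if w = v then 1 else 0"])
  show "(\<lambda>w. if w = v then 1 else 0) \<in> realization_points K"
    by (rule realizationI[OF K v]) auto
  fix a and t :: real assume a: "a \<in> realization_points K" and t: "0 \<le> t" "t \<le> 1"
  obtain \<sigma> where \<sigma>: "\<sigma> \<in> K" "finite \<sigma>" "\<And>w. 0 \<le> a w" "\<And>w. w \<in> \<sigma> \<longleftrightarrow> a w \<noteq> 0" "sum a \<sigma> = 1"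
    using realizationE[OF K a] by metis
  have "sum a (insert v \<sigma>) = 1" using \<sigma> by (auto simp: sum.insert_if)
  moreover have "(\<Sum>w\<in>insert v \<sigma>. if w = v then 1 else 0 :: real) = 1"
    using \<sigma>(2) by simp
  ultimately show "(\<lambda>w. (1 - t) * a w + t * (if w = v then 1 else 0)) \<in> realization_points K"
    using \<sigma> by (intro realization_segment[OF K cone[OF \<sigma>(1)] t]) auto
qed

text \<open>The radial projection from the vertex \<open>v\<close> onto the opposite face. It is
  meaningful where \<open>a v \<noteq> 1\<close>, that is, away from \<open>v\<close> in a
  realization.\<close>

definition proj_away :: "'v \<Rightarrow> ('v \<Rightarrow> real) \<Rightarrow> 'v \<Rightarrow> real" where
  "proj_away v a = (\<lambda>w. if w = v then 0 else a w / (1 - a v))"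

lemma continuous_on_proj_away:
  assumes "\<And>a. a \<in> U \<Longrightarrow> a v \<noteq> 1"
  shows "continuous_on U (proj_away v)"
proof (rule continuous_on_coordinatewise_then_product)
  fix w show "continuous_on U (\<lambda>a. proj_away v a w)"
    unfolding proj_away_def using assms
    by (cases "w = v")
      (auto intro!: continuous_on_divide continuous_on_diff continuous_on_const continuous_on_apply)
qed

lemma realization_proj_away:
  assumes K: "simplicial K" and a: "a \<in> realization_points K" "a v < 1"
  obtains \<sigma> where "\<sigma> \<in> K" "finite \<sigma>" "\<And>w. 0 \<le> a w" "\<And>w. w \<in> \<sigma> \<longleftrightarrow> a w \<noteq> 0" "sum a \<sigma> = 1"
    "\<sigma> - {v} \<noteq> {}" "\<And>w. 0 \<le> proj_away v a w" "\<And>w. w \<notin> \<sigma> - {v} \<Longrightarrow> proj_away v a w = 0"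
    "sum (proj_away v a) (\<sigma> - {v}) = 1"
proof -
  obtain \<sigma> where \<sigma>: "\<sigma> \<in> K" "finite \<sigma>" "\<And>w. 0 \<le> a w" "\<And>w. w \<in> \<sigma> \<longleftrightarrow> a w \<noteq> 0" "sum a \<sigma> = 1"
    using realizationE[OF K a(1)] by metis
  have s: "sum a (\<sigma> - {v}) = 1 - a v" using \<sigma> by (auto simp: sum_diff1)
  have ne: "\<sigma> - {v} \<noteq> {}"
  proof
    assume e: "\<sigma> - {v} = {}"
    show False using s a(2) unfolding e by simp
  qed
  have "sum (proj_away v a) (\<sigma> - {v}) = (\<Sum>w\<in>\<sigma> - {v}. a w / (1 - a v))"
    by (rule sum.cong) (auto simp: proj_away_def)
  also have "\<dots> = 1" using s a(2) by (simp flip: sum_divide_distrib)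
  finally have 1: "sum (proj_away v a) (\<sigma> - {v}) = 1" .
  have 2: "proj_away v a w = 0" if "w \<notin> \<sigma> - {v}" for w
    using that \<sigma>(4)[of w] by (auto simp: proj_away_def)
  have 3: "0 \<le> proj_away v a w" for w
    using \<sigma>(3)[of w] a(2) by (simp add: proj_away_def)
  show ?thesis by (rule that[OF \<sigma> ne 3 2 1])
qed

text \<open>Moving linearly towards \<open>proj_away v a\<close> stays within the support of
  \<open>a\<close> and multiplies the weight of \<open>v\<close> by \<open>1 - t\<close>, so the
  condition \<open>a v < 1\<close> persists.\<close>

lemma fills_deletion_nbhd:
  assumes K: "simplicial K" and del: "fills q (realization_points (deletion K v))"
  shows "fills q {a \<in> realization_points K. a v < 1}"
proof (rule fills_linear_homotopy[OF del, where p = "proj_away v" and i = "\<lambda>x. x"])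
  show "continuous_on {a \<in> realization_points K. a v < 1} (proj_away v)"
    by (rule continuous_on_proj_away) auto
  show "proj_away v \<in> {a \<in> realization_points K. a v < 1} \<rightarrow> realization_points (deletion K v)"
  proof
    fix a assume "a \<in> {a \<in> realization_points K. a v < 1}"
    then have a: "a \<in> realization_points K" "a v < 1" by auto
    obtain \<sigma> where \<sigma>: "\<sigma> \<in> K" "\<sigma> - {v} \<noteq> {}" "\<And>w. 0 \<le> proj_away v a w"
      "\<And>w. w \<notin> \<sigma> - {v} \<Longrightarrow> proj_away v a w = 0" "sum (proj_away v a) (\<sigma> - {v}) = 1"
      by (rule realization_proj_away[OF K a]) blast
    have "\<sigma> - {v} \<in> deletion K v" using simplicialD(3)[OF K \<sigma>(1) Diff_subset \<sigma>(2)] by (simp add: deletion_def)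
    from realizationI[OF simplicial_deletion[OF K] this \<sigma>(3-5)]
    show "proj_away v a \<in> realization_points (deletion K v)" .
  qed
  show "continuous_on (realization_points (deletion K v)) (\<lambda>x. x)" by (rule continuous_on_id)
  show "(\<lambda>x. x) \<in> realization_points (deletion K v) \<rightarrow> {a \<in> realization_points K. a v < 1}"
    by (auto simp: realization_points_def deletion_def)
  fix a and t :: real assume "a \<in> {a \<in> realization_points K. a v < 1}" and t: "0 \<le> t" "t \<le> 1"
  then have a: "a \<in> realization_points K" "a v < 1" by auto
  obtain \<sigma> where \<sigma>: "\<sigma> \<in> K" "finite \<sigma>" "\<And>w. 0 \<le> a w" "\<And>w. w \<in> \<sigma> \<longleftrightarrow> a w \<noteq> 0" "sum a \<sigma> = 1"
    "\<And>w. 0 \<le> proj_away v a w" "\<And>w. w \<notin> \<sigma> - {v} \<Longrightarrow> proj_away v a w = 0"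
    "sum (proj_away v a) (\<sigma> - {v}) = 1"
    by (rule realization_proj_away[OF K a]) blast
  have "sum (proj_away v a) (\<sigma> - {v}) = sum (proj_away v a) \<sigma>"
    by (rule sum.mono_neutral_left) (use \<sigma>(2) in \<open>auto simp: proj_away_def\<close>)
  then have "sum (proj_away v a) \<sigma> = 1" using \<sigma>(8) by simp
  then have "(\<lambda>w. (1 - t) * a w + t * proj_away v a w) \<in> realization_points K"
    using \<sigma> by (intro realization_segment[OF K \<sigma>(1) t]) auto
  moreover have "(1 - t) * a v \<le> a v" using t \<sigma>(3)[of v] by (simp add: mult_left_le_one_le)
  then have "(1 - t) * a v + t * proj_away v a v < 1" using a(2) by (simp add: proj_away_def)
  ultimately show "(\<lambda>w. (1 - t) * a w + t * proj_away v a w) \<in> {a \<in> realization_points K. a v < 1}"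
    by simp
qed

text \<open>The support of each such point contains \<open>v\<close>, so the segment towards
  \<open>v\<close> stays in the same simplex and the weight of \<open>v\<close> stays
  positive.\<close>

lemma fills_star_nbhd:
  assumes K: "simplicial K" and v: "{v} \<in> K"
  shows "fills q {a \<in> realization_points K. 0 < a v}"
proof (rule fills_star_shaped[of "\<lambda>w. if w = v then 1 else 0"])
  show "(\<lambda>w. if w = v then 1 else 0) \<in> {a \<in> realization_points K. 0 < a v}"
    using realizationI[OF K v, of "\<lambda>w. if w = v then 1 else 0"] by auto
  fix a and t :: real assume "a \<in> {a \<in> realization_points K. 0 < a v}" and t: "0 \<le> t" "t \<le> 1"
  then have a: "a \<in> realization_points K" "0 < a v" by auto
  obtain \<sigma> where \<sigma>: "\<sigma> \<in> K" "finite \<sigma>" "\<And>w. 0 \<le> a w" "\<And>w. w \<in> \<sigma> \<longleftrightarrow> a w \<noteq> 0" "sum a \<sigma> = 1"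
    using realizationE[OF K a(1)] by metis
  have "v \<in> \<sigma>" using \<sigma>(4) a(2) by auto
  then have "(\<Sum>w\<in>\<sigma>. if w = v then 1 else 0 :: real) = 1" using \<sigma>(2) by simp
  then have "(\<lambda>w. (1 - t) * a w + t * (if w = v then 1 else 0)) \<in> realization_points K"
    using \<sigma> \<open>v \<in> \<sigma>\<close> by (intro realization_segment[OF K \<sigma>(1) t]) auto
  moreover have "0 < (1 - t) * a v + t * 1"
    using t a(2) by (cases "t = 1") (auto intro: add_pos_nonneg)
  ultimately show "(\<lambda>w. (1 - t) * a w + t * (if w = v then 1 else 0)) \<in> {a \<in> realization_points K. 0 < a v}"
    by simp
qed

text \<open>The set is the product of the link with an open interval, the weight of
  \<open>v\<close>. \<open>proj_away v\<close> projects to the link, and the map back puts the link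
  at the height 1/2; any fixed height strictly between 0 and 1 would serve.\<close>

lemma fills_link_nbhd:
  assumes K: "simplicial K" and lk: "fills q (realization_points (link K v))"
  shows "fills q {a \<in> realization_points K. 0 < a v \<and> a v < 1}"
proof (rule fills_linear_homotopy[OF lk, where p = "proj_away v" and i = "\<lambda>b w. if w = v then 1/2 else b w / 2"])
  show "continuous_on {a \<in> realization_points K. 0 < a v \<and> a v < 1} (proj_away v)"
    by (rule continuous_on_proj_away) auto
  show "continuous_on (realization_points (link K v)) (\<lambda>b w. if w = v then 1/2 else b w / 2)"
  proof (rule continuous_on_coordinatewise_then_product)
    fix w show "continuous_on (realization_points (link K v)) (\<lambda>b. if w = v then 1/2 else b w / 2)"
      by (cases "w = v") (auto intro!: continuous_on_divide continuous_on_const continuous_on_apply)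
  qed
  show "proj_away v \<in> {a \<in> realization_points K. 0 < a v \<and> a v < 1} \<rightarrow> realization_points (link K v)"
  proof
    fix a assume "a \<in> {a \<in> realization_points K. 0 < a v \<and> a v < 1}"
    then have a: "a \<in> realization_points K" "a v < 1" and av: "0 < a v" by auto
    obtain \<sigma> where \<sigma>: "\<sigma> \<in> K" "\<And>w. w \<in> \<sigma> \<longleftrightarrow> a w \<noteq> 0" "\<sigma> - {v} \<noteq> {}" "\<And>w. 0 \<le> proj_away v a w"
      "\<And>w. w \<notin> \<sigma> - {v} \<Longrightarrow> proj_away v a w = 0" "sum (proj_away v a) (\<sigma> - {v}) = 1"
      by (rule realization_proj_away[OF K a]) blast
    have "insert v (\<sigma> - {v}) = \<sigma>" using \<sigma>(2)[of v] av by auto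
    then have "\<sigma> - {v} \<in> link K v" using \<sigma>(1,3) by (simp add: link_def)
    from realizationI[OF simplicial_link[OF K] this \<sigma>(4-6)]
    show "proj_away v a \<in> realization_points (link K v)" .
  qed
  show "(\<lambda>b w. if w = v then 1/2 else b w / 2) \<in> realization_points (link K v) \<rightarrow> {a \<in> realization_points K. 0 < a v \<and> a v < 1}"
  proof
    fix b assume "b \<in> realization_points (link K v)"
    then obtain \<sigma> where \<sigma>: "\<sigma> \<in> link K v" "finite \<sigma>" "\<And>w. 0 \<le> b w" "\<And>w. w \<in> \<sigma> \<longleftrightarrow> b w \<noteq> 0" "sum b \<sigma> = 1"
      using realizationE[OF simplicial_link[OF K]] by metis
    have v: "v \<notin> \<sigma>" "insert v \<sigma> \<in> K" using \<sigma>(1) by (auto simp: link_def)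
    have "(\<lambda>w. if w = v then 1/2 else b w / 2) \<in> realization_points K"
    proof (rule realizationI[OF K v(2)])
      have "(\<Sum>w\<in>insert v \<sigma>. if w = v then 1/2 else b w / 2) = 1/2 + (\<Sum>w\<in>\<sigma>. if w = v then 1/2 else b w / 2)"
        using \<sigma>(2) v(1) by simp
      also have "(\<Sum>w\<in>\<sigma>. if w = v then 1/2 else b w / 2) = (\<Sum>w\<in>\<sigma>. b w / 2)"
        using v(1) by (intro sum.cong) auto
      also have "\<dots> = 1/2" using \<sigma>(5) by (simp flip: sum_divide_distrib)
      finally show "(\<Sum>w\<in>insert v \<sigma>. if w = v then 1/2 else b w / 2) = 1" by simp
    qed (use \<sigma> in auto)
    then show "(\<lambda>w. if w = v then 1/2 else b w / 2) \<in> {a \<in> realization_points K. 0 < a v \<and> a v < 1}"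
      by simp
  qed
  fix a and t :: real assume "a \<in> {a \<in> realization_points K. 0 < a v \<and> a v < 1}" and t: "0 \<le> t" "t \<le> 1"
  then have a: "a \<in> realization_points K" "a v < 1" and av: "0 < a v" by auto
  obtain \<sigma> where \<sigma>: "\<sigma> \<in> K" "finite \<sigma>" "\<And>w. 0 \<le> a w" "\<And>w. w \<in> \<sigma> \<longleftrightarrow> a w \<noteq> 0" "sum a \<sigma> = 1"
    "\<And>w. 0 \<le> proj_away v a w" "\<And>w. w \<notin> \<sigma> - {v} \<Longrightarrow> proj_away v a w = 0"
    "sum (proj_away v a) (\<sigma> - {v}) = 1"
    by (rule realization_proj_away[OF K a]) blast
  define c where "c = (\<lambda>w. if w = v then 1/2 else proj_away v a w / 2)"
  have v\<sigma>: "v \<in> \<sigma>" using \<sigma>(4) av by auto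
  have "sum c \<sigma> = c v + sum c (\<sigma> - {v})" using \<sigma>(2) v\<sigma> by (rule sum.remove)
  also have "sum c (\<sigma> - {v}) = (\<Sum>w\<in>\<sigma> - {v}. proj_away v a w / 2)"
    by (rule sum.cong) (auto simp: c_def)
  also have "\<dots> = 1/2" using \<sigma>(8) by (simp flip: sum_divide_distrib)
  finally have "sum c \<sigma> = 1" by (simp add: c_def)
  moreover have "0 \<le> c w" for w using \<sigma>(6) by (simp add: c_def)
  moreover have "c w = 0" if "w \<notin> \<sigma>" for w using that v\<sigma> \<sigma>(7)[of w] by (auto simp: c_def)
  ultimately have "(\<lambda>w. (1 - t) * a w + t * c w) \<in> realization_points K"
    using \<sigma> by (intro realization_segment[OF K \<sigma>(1) t]) auto
  moreover have "0 < (1 - t) * a v + t * c v"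
    using t av by (cases "t = 1") (auto simp: c_def intro: add_pos_nonneg)
  moreover have "(1 - t) * a v + t * c v < 1"
  proof (cases "t = 1")
    case False
    then have "(1 - t) * a v < (1 - t) * 1" using t a(2) by (intro mult_strict_left_mono) auto
    then show ?thesis using t by (simp add: c_def)
  qed (simp add: c_def)
  ultimately show "(\<lambda>w. (1 - t) * a w + t * (if w = v then 1/2 else proj_away v a w / 2)) \<in> {a \<in> realization_points K. 0 < a v \<and> a v < 1}"
    by (simp add: c_def)
qed

text \<open>The realization is the deletion with a cone over the link attached. Thickened to open
  sets this is the cover by \<open>a v < 1\<close>, which retracts to the deletion, and
  \<open>0 < a v\<close>, which is contractible; their intersection is dominated by the
  link.\<close>

lemma fills_deletion_link:
  assumes K: "simplicial K"
    and del: "fills q (realization_points (deletion K v))"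
    and lk: "fills (q - 1) (realization_points (link K v))"
  shows "fills q (realization_points K)"
proof (cases "{v} \<in> K")
  case False
  then have "v \<notin> \<sigma>" if "\<sigma> \<in> K" for \<sigma> using simplicialD(3)[OF K that, of "{v}"] by auto
  then have "deletion K v = K" by (auto simp: deletion_def)
  then show ?thesis using del by simp
next
  case True
  let ?U = "{a \<in> realization_points K. a v < 1}" and ?V = "{a \<in> realization_points K. 0 < a v}"
  show ?thesis
  proof (rule fills_open_cover[of _ ?U ?V])
    have "open {a :: 'a \<Rightarrow> real. a v < 1}" "open {a :: 'a \<Rightarrow> real. 0 < a v}"
      by (auto intro!: open_Collect_less continuous_on_const continuous_on_apply)
    moreover have "?U = realization_points K \<inter> {a. a v < 1}" "?V = realization_points K \<inter> {a. 0 < a v}"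
      by auto
    ultimately show "openin (top_of_set (realization_points K)) ?U" "openin (top_of_set (realization_points K)) ?V"
      unfolding openin_open by blast+
    show "realization_points K = ?U \<union> ?V" by auto
    show "fills q ?U" by (rule fills_deletion_nbhd[OF K del])
    show "fills q ?V" by (rule fills_star_nbhd[OF K True])
    have "?U \<inter> ?V = {a \<in> realization_points K. 0 < a v \<and> a v < 1}" by auto
    then show "fills (q - 1) (?U \<inter> ?V)" using fills_link_nbhd[OF K lk] by simp
  qed
qed

text \<open>Relabelling vertices is a homeomorphism of realizations. Since points are functions on
  the whole type, both directions put 0 outside the vertex sets. As \<open>i\<close> after
  \<open>p\<close> is the identity on the realization, \<open>fills_linear_homotopy\<close> applies
  with constant segments.\<close>

lemma fills_image_complex:
  assumes K: "simplicial K" and inj: "inj_on \<iota> (\<Union>K)" and fK: "fills q (realization_points K)"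
  shows "fills q (realization_points ((`) \<iota> ` K))"
proof -
  let ?V = "\<Union>K"
  define p where "p b = (\<lambda>v. if v \<in> ?V then b (\<iota> v) else 0 :: real)" for b
  define i where "i a = (\<lambda>w. if w \<in> \<iota> ` ?V then a (inv_into ?V \<iota> w) else 0 :: real)" for a
  have K': "simplicial ((`) \<iota> ` K)"
  proof -
    have "\<tau> \<in> (`) \<iota> ` K" if \<tau>: "\<sigma> \<in> K" "\<tau> \<subseteq> \<iota> ` \<sigma>" "\<tau> \<noteq> {}" for \<sigma> \<tau>
    proof -
      obtain \<rho> where \<rho>: "\<rho> \<subseteq> \<sigma>" "\<tau> = \<iota> ` \<rho>" using \<tau>(2) by (auto simp: subset_image_iff)
      then have "\<rho> \<noteq> {}" using \<tau>(3) by blast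
      then have "\<rho> \<in> K" using simplicialD(3)[OF K \<tau>(1) \<rho>(1)] by blast
      then show ?thesis using \<rho>(2) by blast
    qed
    moreover have "{} \<notin> K" using simplicialD(2)[OF K, of "{}"] by auto
    ultimately show ?thesis using simplicialD(1)[OF K] by (intro simplicialI) auto
  qed
  have ip: "i (p b) = b" if b: "b \<in> realization_points ((`) \<iota> ` K)" for b
  proof
    fix w
    obtain \<sigma> where \<sigma>: "\<sigma> \<in> (`) \<iota> ` K" "\<And>w. w \<in> \<sigma> \<longleftrightarrow> b w \<noteq> 0"
      using realizationE[OF K' b] by metis
    show "i (p b) w = b w"
    proof (cases "w \<in> \<iota> ` ?V")
      case True
      then show ?thesis by (simp add: i_def p_def inv_into_into f_inv_into_f del: Union_iff)
    next
      case False
      then have "w \<notin> \<sigma>" using \<sigma>(1) by blast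
      then show ?thesis using False \<sigma>(2)[of w] by (simp add: i_def del: Union_iff)
    qed
  qed
  show ?thesis
  proof (rule fills_linear_homotopy[OF fK, where p = p and i = i])
    show "continuous_on (realization_points ((`) \<iota> ` K)) p"
    proof (rule continuous_on_coordinatewise_then_product)
      fix v show "continuous_on (realization_points ((`) \<iota> ` K)) (\<lambda>b. p b v)"
        unfolding p_def by (cases "v \<in> ?V") (auto intro: continuous_on_const continuous_on_apply)
    qed
    show "continuous_on (realization_points K) i"
    proof (rule continuous_on_coordinatewise_then_product)
      fix w show "continuous_on (realization_points K) (\<lambda>a. i a w)"
        unfolding i_def by (cases "w \<in> \<iota> ` ?V") (auto intro: continuous_on_const continuous_on_apply)
    qed
    show "p \<in> realization_points ((`) \<iota> ` K) \<rightarrow> realization_points K"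
    proof
      fix b assume b: "b \<in> realization_points ((`) \<iota> ` K)"
      obtain \<tau> where \<tau>: "\<tau> \<in> (`) \<iota> ` K" "\<And>w. 0 \<le> b w" "\<And>w. w \<in> \<tau> \<longleftrightarrow> b w \<noteq> 0" "sum b \<tau> = 1"
        using realizationE[OF K' b] by metis
      obtain \<sigma> where \<sigma>: "\<sigma> \<in> K" "\<tau> = \<iota> ` \<sigma>" using \<tau>(1) by blast
      have sub: "\<sigma> \<subseteq> ?V" using \<sigma>(1) by blast
      show "p b \<in> realization_points K"
      proof (rule realizationI[OF K \<sigma>(1)])
        show "0 \<le> p b v" for v using \<tau>(2) by (simp add: p_def)
        show "p b v = 0" if "v \<notin> \<sigma>" for v
        proof (cases "v \<in> ?V")
          case True
          then have "\<iota> v \<notin> \<iota> ` \<sigma>" using inj_on_image_mem_iff[OF inj True sub] that by simp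
          then show ?thesis using \<tau>(3)[of "\<iota> v"] \<sigma>(2) by (simp add: p_def)
        qed (simp add: p_def)
        have "sum (p b) \<sigma> = (\<Sum>v\<in>\<sigma>. b (\<iota> v))" using sub by (intro sum.cong) (auto simp: p_def)
        also have "\<dots> = sum b \<tau>" unfolding \<sigma>(2)
          using sum.reindex[OF inj_on_subset[OF inj sub], of b] by (simp add: o_def)
        finally show "sum (p b) \<sigma> = 1" using \<tau>(4) by simp
      qed
    qed
    show "i \<in> realization_points K \<rightarrow> realization_points ((`) \<iota> ` K)"
    proof
      fix a assume a: "a \<in> realization_points K"
      obtain \<sigma> where \<sigma>: "\<sigma> \<in> K" "\<And>w. 0 \<le> a w" "\<And>w. w \<in> \<sigma> \<longleftrightarrow> a w \<noteq> 0" "sum a \<sigma> = 1"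
        using realizationE[OF K a] by metis
      have sub: "\<sigma> \<subseteq> ?V" using \<sigma>(1) by blast
      have \<sigma>': "\<iota> ` \<sigma> \<in> (`) \<iota> ` K" using \<sigma>(1) by blast
      show "i a \<in> realization_points ((`) \<iota> ` K)"
      proof (rule realizationI[OF K' \<sigma>'])
        show "0 \<le> i a w" for w using \<sigma>(2) by (simp add: i_def)
        show "i a w = 0" if "w \<notin> \<iota> ` \<sigma>" for w
        proof (cases "w \<in> \<iota> ` ?V")
          case True
          then have "inv_into ?V \<iota> w \<notin> \<sigma>" using that f_inv_into_f[OF True] by (metis image_eqI)
          then show ?thesis using \<sigma>(3) by (simp add: i_def)
        qed (simp add: i_def)
        have "sum (i a) (\<iota> ` \<sigma>) = (\<Sum>v\<in>\<sigma>. i a (\<iota> v))"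
          using sum.reindex[OF inj_on_subset[OF inj sub], of "i a"] by (simp add: o_def)
        also have "\<dots> = sum a \<sigma>"
        proof (rule sum.cong[OF refl])
          fix v assume "v \<in> \<sigma>"
          then have "v \<in> ?V" using sub by blast
          then show "i a (\<iota> v) = a v" using inv_into_f_f[OF inj] by (simp add: i_def del: Union_iff)
        qed
        finally show "sum (i a) (\<iota> ` \<sigma>) = 1" using \<sigma>(4) by simp
      qed
    qed
    fix b and t :: real assume b: "b \<in> realization_points ((`) \<iota> ` K)"
    have "(\<lambda>v. (1 - t) * b v + t * i (p b) v) = b" unfolding ip[OF b] by (simp add: algebra_simps)
    then show "(\<lambda>v. (1 - t) * b v + t * i (p b) v) \<in> realization_points ((`) \<iota> ` K)" using b by simp
  qed
qed

section \<open>Vanishing of homotopy groups\<close>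

lemma fills_nonempty:
  assumes "fills q S" "0 < q"
  shows "S \<noteq> {}"
proof -
  obtain g :: "(nat \<Rightarrow> real) \<Rightarrow> 'a" where "g \<in> unit_cube 0 \<rightarrow> S"
    by (rule fillsD[OF assms, of "\<lambda>_. undefined"]) (auto simp: cube_boundary_eq)
  then have "g (\<lambda>_. undefined) \<in> S" by auto
  then show ?thesis by blast
qed

lemma based_cubes_eq:
  "based_cubes j (top_of_set S) x = {f. continuous_on (unit_cube j) f \<and> f \<in> unit_cube j \<rightarrow> S \<and> (\<forall>c\<in>cube_boundary j. f c = x)}"
  by (auto simp: based_cubes_def boundary_at_def cube_eq)

text \<open>A based null homotopy of \<open>f\<close> is a filling one dimension higher: on the
  boundary of the cube of dimension \<open>Suc j\<close>, take \<open>f\<close> on the bottom face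
  and the constant \<open>x\<close> on all other faces. On the overlap \<open>f\<close> is
  \<open>x\<close>, because it is based. This is why \<open>Suc j < q\<close> is required.\<close>

lemma based_homotopy_const:
  fixes S :: "'a::topological_space set"
  assumes S: "fills q S" and j: "Suc j < q" and x: "x \<in> S" and f: "f \<in> based_cubes j (top_of_set S) x"
  shows "(f, \<lambda>_. x) \<in> based_homotopy j (top_of_set S) x"
proof -
  have f: "continuous_on (unit_cube j) f" "f \<in> unit_cube j \<rightarrow> S" "\<And>c. c \<in> cube_boundary j \<Longrightarrow> f c = x"
    using f by (auto simp: based_cubes_eq)
  \<comment> \<open>\<open>A\<close> is the bottom face, where the last coordinate \<open>j\<close>
    is 0, and \<open>B\<close> is the union of all other faces. Coordinate \<open>j\<close> becomes
    the time of the homotopy.\<close>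
  define A where "A = cube_boundary (Suc j) \<inter> {z. z j \<in> {0}}"
  define B where "B = cube_boundary (Suc j) \<inter> ((\<Union>i\<in>{..<j}. {z. z i \<in> {0, 1}}) \<union> {z. z j \<in> {1}})"
  have bsub: "c \<in> unit_cube j" if "c \<in> cube_boundary j" for c
    using that by (simp add: cube_boundary_eq)
  have cl: "closed {z :: nat \<Rightarrow> real. z i \<in> T}" if "finite T" for i T
    using continuous_closed_preimage[OF continuous_on_apply[of UNIV i], of T] that
    by (simp add: vimage_def finite_imp_closed)
  have clA: "closed A" unfolding A_def by (intro closed_Int closed_cube_boundary cl) simp
  have clB: "closed B" unfolding B_def
    by (intro closed_Int closed_cube_boundary closed_Un closed_UN ballI cl) auto
  have AB: "cube_boundary (Suc j) = A \<union> B"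
    unfolding A_def B_def cube_boundary_eq by (auto simp: less_Suc_eq)
  define \<rho> where "\<rho> z = restrict z {..<j}" for z :: "nat \<Rightarrow> real"
  have \<rho>: "\<rho> z \<in> unit_cube j" if "z \<in> unit_cube (Suc j)" for z
    using that by (auto simp: \<rho>_def PiE_iff)
  define e where "e z = (if z \<in> A then f (\<rho> z) else x)" for z
  have \<rho>A: "\<rho> z \<in> unit_cube j" if "z \<in> A" for z
    using that \<rho> by (simp add: A_def cube_boundary_eq)
  have overlap: "f (\<rho> z) = x" if "z \<in> A" "z \<in> B" for z
  proof (rule f(3))
    show "\<rho> z \<in> cube_boundary j"
      using that \<rho>A[OF that(1)] unfolding A_def B_def cube_boundary_eq by (auto simp: \<rho>_def)
  qed
  have "continuous_on (cube_boundary (Suc j)) e"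
    unfolding AB e_def
  proof (rule continuous_on_closed_glue[OF clA clB _ continuous_on_const overlap])
    show "continuous_on A (\<lambda>z. f (\<rho> z))"
    proof (rule continuous_on_compose2[OF f(1)])
      show "continuous_on A \<rho>" unfolding \<rho>_def[abs_def]
        by (intro continuous_on_restrict_fun continuous_on_apply)
    qed (use \<rho>A in auto)
  qed
  moreover have "e \<in> cube_boundary (Suc j) \<rightarrow> S"
    using f(2) x \<rho>A by (auto simp: e_def Pi_iff)
  ultimately obtain G where G: "continuous_on (unit_cube (Suc j)) G" "G \<in> unit_cube (Suc j) \<rightarrow> S"
    "\<And>z. z \<in> cube_boundary (Suc j) \<Longrightarrow> G z = e z"
    by (rule fillsD[OF S j]) blast
  define lift where "lift p = restrict (\<lambda>i. if i = j then fst p else snd p i) {..<Suc j}" for p :: "real \<times> (nat \<Rightarrow> real)"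
  have lift: "lift p \<in> unit_cube (Suc j)" if "p \<in> {0..1} \<times> unit_cube j" for p
  proof -
    have p: "fst p \<in> {0..1}" "snd p \<in> unit_cube j" using that by (simp_all add: mem_Times_iff)
    have "(if i = j then fst p else snd p i) \<in> {0..1}" if "i \<in> {..<Suc j}" for i
      using p(1) PiE_mem[OF p(2), of i] that by (cases "i = j") simp_all
    then show ?thesis unfolding lift_def restrict_PiE_iff by blast
  qed
  have \<rho>lift: "\<rho> (lift (t, c)) = c" if "c \<in> unit_cube j" for t c
    using that by (auto simp: \<rho>_def lift_def fun_eq_iff PiE_iff extensional_def)
  have eB: "e z = x" if "z \<in> B" for z using overlap that by (auto simp: e_def)
  have "continuous_on ({0..1} \<times> unit_cube j) (\<lambda>p. G (lift p))"
  proof (rule continuous_on_compose2[OF G(1)])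
    show "continuous_on ({0..1} \<times> unit_cube j) lift"
      unfolding lift_def[abs_def]
    proof (rule continuous_on_restrict_fun)
      fix i show "continuous_on ({0..1} \<times> unit_cube j) (\<lambda>p. if i = j then fst p else snd p i)"
        using continuous_on_product_then_coordinatewise[OF continuous_on_snd[OF continuous_on_id], of "{0..1} \<times> unit_cube j" i]
        by (cases "i = j") (simp_all add: continuous_on_fst)
    qed
  qed (use lift in blast)
  moreover have "(\<lambda>p. G (lift p)) \<in> {0..1} \<times> unit_cube j \<rightarrow> S"
    by (rule funcsetI) (rule funcset_mem[OF G(2) lift])
  moreover have "G (lift (0, c)) = f c" if c: "c \<in> unit_cube j" for c
  proof -
    have "lift (0, c) \<in> A"
      using lift[of "(0, c)"] c unfolding A_def cube_boundary_eq by (auto simp: lift_def)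
    then show ?thesis using G(3) AB \<rho>lift[OF c] by (auto simp: e_def)
  qed
  moreover have "G (lift (1, c)) = x" if c: "c \<in> unit_cube j" for c
  proof -
    have "lift (1, c) \<in> B"
      using lift[of "(1, c)"] c unfolding B_def cube_boundary_eq by (auto simp: lift_def)
    then show ?thesis using G(3) AB eB by auto
  qed
  moreover have "G (lift (t, c)) = x" if t: "t \<in> {0..1}" and c: "c \<in> cube_boundary j" for t c
  proof -
    obtain i where i: "i < j" "c i = 0 \<or> c i = 1" and cu: "c \<in> unit_cube j"
      using c unfolding cube_boundary_eq by blast
    have "lift (t, c) i = c i" using i(1) by (simp add: lift_def)
    then have "lift (t, c) \<in> B"
      using lift[of "(t, c)"] t cu i unfolding B_def cube_boundary_eq by auto
    then show ?thesis using G(3) AB eB by auto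
  qed
  ultimately have "homotopic_with (boundary_at j x) (cube j) (top_of_set S) f (\<lambda>_. x)"
    unfolding cube_eq
    using bsub by (subst homotopic_with)
      (auto simp: boundary_at_def subset_iff intro!: exI[of _ "\<lambda>p. G (lift p)"])
  then show ?thesis using f x by (auto simp: based_homotopy_def based_cubes_eq continuous_on_const)
qed

text \<open>Degree \<open>j\<close> uses fillings in dimension \<open>j + 1\<close>, and
  \<open>fills q\<close> covers dimensions below \<open>q\<close>, hence the shift by two.
  Nonemptiness is required for negative \<open>k\<close> as well, and comes from dimension
  0.\<close>

lemma k_connected_fills:
  fixes S :: "'a::topological_space set"
  assumes S: "fills q S" and q: "0 < q" "k + 2 \<le> int q"
  shows "k_connected k (top_of_set S)"
  unfolding k_connected_def
proof (intro conjI allI impI ballI)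
  show "topspace (top_of_set S) \<noteq> {}" using fills_nonempty[OF S q(1)] by simp
  fix j :: nat and x assume "int j \<le> k" and "x \<in> topspace (top_of_set S)"
  then have j: "Suc j < q" and x: "x \<in> S" using q by auto
  have c: "(\<lambda>_. x) \<in> based_cubes j (top_of_set S) x"
    using x by (auto simp: based_cubes_eq continuous_on_const)
  have "based_homotopy j (top_of_set S) x `` {f} = based_homotopy j (top_of_set S) x `` {\<lambda>_. x}"
    if "f \<in> based_cubes j (top_of_set S) x" for f
    by (rule equiv_class_eq[OF equiv_based_homotopy based_homotopy_const[OF S j x that]])
  with c show "homotopy_group_vanishes j (top_of_set S) x"
    unfolding homotopy_group_vanishes_def homotopy_classes_def quotient_def by blast
qed

section \<open>Complexes of strips\<close>

type_synonym side = "bool \<times> nat"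

text \<open>Opposite sides at distance at most 1 on the line, written without truncated subtraction.
  Conflicts around the end of the polygon are added in \<open>cyclic_conflict\<close>.\<close>

definition conflict :: "side \<Rightarrow> side \<Rightarrow> bool" where
  "conflict p q \<longleftrightarrow> fst p \<noteq> fst q \<and> snd p \<le> snd q + 1 \<and> snd q \<le> snd p + 1"

text \<open>The independence complex of the graph \<open>conflict\<close> restricted to
  \<open>W\<close>. Deletions and links of vertices are again of this form.\<close>

definition indep :: "side set \<Rightarrow> side set set" where
  "indep W = {\<sigma>. \<sigma> \<noteq> {} \<and> finite \<sigma> \<and> \<sigma> \<subseteq> W \<and> (\<forall>p\<in>\<sigma>. \<forall>q\<in>\<sigma>. \<not> conflict p q)}"

text \<open>The set \<open>Z\<close> will be what remains to complete a directed cycle. Deleting a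
  vertex of \<open>Z\<close> removes the restriction altogether; passing to its link removes that
  vertex from \<open>Z\<close>.\<close>

definition indep_avoiding :: "side set \<Rightarrow> side set \<Rightarrow> side set set" where
  "indep_avoiding W Z = {\<sigma> \<in> indep W. \<not> Z \<subseteq> \<sigma>}"

abbreviation complex_fills :: "nat \<Rightarrow> side set set \<Rightarrow> bool" where
  "complex_fills q K \<equiv> fills q (realization_points K)"

lemma conflict_sym: "conflict p q \<longleftrightarrow> conflict q p"
  by (auto simp: conflict_def)

lemma conflict_irrefl [simp]: "\<not> conflict p p"
  by (simp add: conflict_def)

lemma simplicial_indep: "simplicial (indep W)"
  by (rule simplicialI) (auto simp: indep_def intro: finite_subset)

lemma simplicial_indep_avoiding: "simplicial (indep_avoiding W Z)"
  by (rule simplicialI) (auto simp: indep_avoiding_def indep_def intro: finite_subset)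

lemma complex_fills_0: "complex_fills 0 K"
  by (simp add: fills_def)

lemma complex_fills_cone:
  assumes "p \<in> W" "\<And>q. q \<in> W \<Longrightarrow> \<not> conflict p q"
  shows "complex_fills q (indep W)"
proof (rule fills_cone[OF simplicial_indep])
  show "{p} \<in> indep W" using assms by (auto simp: indep_def)
  show "insert p \<sigma> \<in> indep W" if "\<sigma> \<in> indep W" for \<sigma>
    using that assms conflict_sym unfolding indep_def by blast
qed

lemma deletion_indep: "v \<notin> W \<Longrightarrow> deletion (indep (insert v W)) v = indep W"
  by (auto simp: deletion_def indep_def)

lemma link_indep: "v \<notin> W \<Longrightarrow> link (indep (insert v W)) v = indep {w \<in> W. \<not> conflict v w}"
  unfolding link_def indep_def using conflict_sym conflict_irrefl by (auto 4 4)

lemma complex_fills_insert: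
  assumes "v \<notin> W" "complex_fills q (indep W)" "complex_fills (q - 1) (indep {w \<in> W. \<not> conflict v w})"
  shows "complex_fills q (indep (insert v W))"
  by (rule fills_deletion_link[OF simplicial_indep, of _ _ v]) (use assms in \<open>simp_all add: deletion_indep link_indep\<close>)

lemma deletion_indep_avoiding:
  "v \<notin> W \<Longrightarrow> v \<in> Z \<Longrightarrow> deletion (indep_avoiding (insert v W) Z) v = indep W"
  by (auto simp: deletion_def indep_avoiding_def indep_def)

lemma link_indep_avoiding:
  "v \<notin> W \<Longrightarrow> v \<in> Z \<Longrightarrow>
    link (indep_avoiding (insert v W) Z) v = indep_avoiding {w \<in> W. \<not> conflict v w} (Z - {v})"
  unfolding link_def indep_avoiding_def indep_def using conflict_sym conflict_irrefl by (auto 4 4)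

lemma complex_fills_insert_avoiding:
  assumes "v \<notin> W" "v \<in> Z" "complex_fills q (indep W)"
    "complex_fills (q - 1) (indep_avoiding {w \<in> W. \<not> conflict v w} (Z - {v}))"
  shows "complex_fills q (indep_avoiding (insert v W) Z)"
  by (rule fills_deletion_link[OF simplicial_indep_avoiding, of _ _ _ v])
    (use assms in \<open>simp_all add: deletion_indep_avoiding link_indep_avoiding\<close>)

text \<open>The two sides at position \<open>l\<close> conflict with each other but with nothing
  from \<open>l + 2\<close> on, so they are the cone points of a suspension. Adding the sides at
  \<open>l + 1\<close> preserves \<open>fills q\<close>, since their links are cones. A strip of one
  position consists of two isolated points, hence is filled for \<open>q = 1\<close>.\<close>

lemma complex_fills_strip: "2 * q \<le> s + 1 \<Longrightarrow> complex_fills q (indep (UNIV \<times> {l..<l + s}))"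
proof (induction s arbitrary: l q rule: less_induct)
  case (less s)
  consider "q = 0" | "s = 1" "q = 1" | "2 \<le> s" "0 < q" using less.prems by linarith
  then show ?case
  proof cases
    case 1
    then show ?thesis by (simp add: complex_fills_0)
  next
    case 2
    let ?W = "{(True, l), (False, l)} :: side set"
    have "complex_fills 1 (indep (insert (True, l) {(False, l)}))"
    proof (rule complex_fills_insert)
      show "complex_fills 1 (indep {(False, l)})" by (rule complex_fills_cone[of "(False, l)"]) auto
    qed (auto simp: complex_fills_0)
    moreover have "UNIV \<times> {l..<l + 1} = ?W" by (auto simp: UNIV_bool)
    ultimately show ?thesis using 2 by simp
  next
    case 3
    let ?W = "UNIV \<times> {l + 2..<l + 2 + (s - 2)} :: side set"
    have IH: "complex_fills (q - 1) (indep ?W)"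
      by (rule less.IH) (use less.prems 3 in auto)
    \<comment> \<open>When \<open>(True, l + 1)\<close> is added, \<open>(True, l)\<close> is a cone
      point of its link: of its two partners in conflict, \<open>(False, l)\<close> is excluded by
      \<open>(True, l + 1)\<close> and \<open>(False, l + 1)\<close> is not yet present. For
      \<open>(False, l + 1)\<close> the cone point is \<open>(False, l)\<close>, whose partners
      \<open>(True, l)\<close> and \<open>(True, l + 1)\<close> are both excluded.\<close>
    let ?W1 = "insert (False, l) ?W" let ?W2 = "insert (True, l) ?W1"
    let ?W3 = "insert (True, l + 1) ?W2" let ?W4 = "insert (False, l + 1) ?W3"
    have 1: "complex_fills q (indep ?W1)"
      by (rule complex_fills_cone[of "(False, l)"]) (auto simp: conflict_def)
    have 2: "complex_fills q (indep ?W2)"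
    proof (rule complex_fills_insert[OF _ 1])
      have "{w \<in> ?W1. \<not> conflict (True, l) w} = ?W" by (auto simp: conflict_def)
      with IH show "complex_fills (q - 1) (indep {w \<in> ?W1. \<not> conflict (True, l) w})" by simp
    qed auto
    have 3: "complex_fills q (indep ?W3)"
      by (rule complex_fills_insert[OF _ 2], simp, rule complex_fills_cone[of "(True, l)"]) (auto simp: conflict_def)
    have "complex_fills q (indep ?W4)"
      by (rule complex_fills_insert[OF _ 3], simp, rule complex_fills_cone[of "(False, l)"]) (auto simp: conflict_def)
    moreover have "UNIV \<times> {l..<l + s} = ?W4"
      using \<open>2 \<le> s\<close> by (auto simp: UNIV_bool)
    ultimately show ?thesis by simp
  qed
qed

text \<open>The shape arises when \<open>(x, l - 1)\<close> is attached to a strip starting at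
  \<open>l\<close>: its link loses exactly \<open>(\<not> x, l)\<close>. It reproduces itself, since
  the link of \<open>(x, l)\<close> is the notched strip starting at \<open>Suc l\<close>; there
  \<open>2 * q + 1\<close> has dropped by 2 and only one position has been used.\<close>

lemma complex_fills_notched_strip:
  "2 * q + 1 \<le> s \<Longrightarrow> complex_fills q (indep (UNIV \<times> {l..<l + s} - {(\<not> x, l)}))"
proof (induction s arbitrary: l q)
  case (Suc s)
  show ?case
  proof (cases "q = 0")
    case False
    let ?W = "UNIV \<times> {Suc l..<Suc l + s} :: side set"
    have "complex_fills q (indep (insert (x, l) ?W))"
    proof (rule complex_fills_insert)
      show "complex_fills q (indep ?W)" by (rule complex_fills_strip) (use Suc.prems in simp)
      have "{w \<in> ?W. \<not> conflict (x, l) w} = ?W - {(\<not> x, Suc l)}"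
        by (auto simp: conflict_def)
      then show "complex_fills (q - 1) (indep {w \<in> ?W. \<not> conflict (x, l) w})"
        using Suc.IH[of "q - 1" "Suc l"] Suc.prems False by simp
    qed auto
    moreover have "UNIV \<times> {l..<l + Suc s} - {(\<not> x, l)} = insert (x, l) ?W"
      by auto
    ultimately show ?thesis by simp
  qed (simp add: complex_fills_0)
qed (simp add: complex_fills_0)

text \<open>For \<open>s = n - 2\<close> this is the link of \<open>(x, n)\<close> in the polygon,
  and the forbidden set is the rest of the directed cycle. Deleting the last side of direction
  \<open>x\<close> leaves a strip with \<open>(x, 0)\<close> attached along a notched strip; the
  link of that last side has the same shape with one position less.\<close>

lemma complex_fills_unbalanced_strip:
  "2 * q \<le> s + 1 \<Longrightarrow>
    complex_fills q (indep_avoiding ({x} \<times> {0..Suc s} \<union> {\<not> x} \<times> {1..s}) ({x} \<times> {0..Suc s}))"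
proof (induction s arbitrary: q)
  case 0
  then have "q = 0" by simp
  then show ?case by (simp add: complex_fills_0)
next
  case (Suc s)
  show ?case
  proof (cases "q = 0")
    case False
    let ?W0 = "UNIV \<times> {1..<1 + Suc s} :: side set"
    let ?W1 = "insert (x, 0) ?W0" and ?Z = "{x} \<times> {0..Suc (Suc s)}"
    have "complex_fills q (indep ?W1)"
    proof (rule complex_fills_insert)
      show "complex_fills q (indep ?W0)" by (rule complex_fills_strip) (use Suc.prems in simp)
      have "{w \<in> ?W0. \<not> conflict (x, 0) w} = ?W0 - {(\<not> x, 1)}" by (auto simp: conflict_def)
      then show "complex_fills (q - 1) (indep {w \<in> ?W0. \<not> conflict (x, 0) w})"
        using complex_fills_notched_strip[of "q - 1" "Suc s" 1 x] Suc.prems False by simp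
    qed auto
    then have "complex_fills q (indep_avoiding (insert (x, Suc (Suc s)) ?W1) ?Z)"
    proof (rule complex_fills_insert_avoiding[rotated 2])
      have "{w \<in> ?W1. \<not> conflict (x, Suc (Suc s)) w} = {x} \<times> {0..Suc s} \<union> {\<not> x} \<times> {1..s}"
        by (auto simp: conflict_def)
      moreover have "?Z - {(x, Suc (Suc s))} = {x} \<times> {0..Suc s}" by auto
      ultimately show "complex_fills (q - 1) (indep_avoiding {w \<in> ?W1. \<not> conflict (x, Suc (Suc s)) w} (?Z - {(x, Suc (Suc s))}))"
        using Suc.IH[of "q - 1"] Suc.prems False by simp
    qed auto
    moreover have "insert (x, Suc (Suc s)) ?W1 = {x} \<times> {0..Suc (Suc s)} \<union> {\<not> x} \<times> {1..Suc s}"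
      by auto
    ultimately show ?thesis by simp
  qed (simp add: complex_fills_0)
qed

section \<open>The complex of the whole polygon\<close>

definition cyclic_conflict :: "nat \<Rightarrow> side \<Rightarrow> side \<Rightarrow> bool" where
  "cyclic_conflict n p q \<longleftrightarrow> conflict p q \<or> fst p \<noteq> fst q \<and> (snd p = 0 \<and> snd q = n \<or> snd p = n \<and> snd q = 0)"

text \<open>The last condition excludes the two directed cycles, whose sides are pairwise free of
  conflicts.\<close>

definition cyclic_complex :: "nat \<Rightarrow> side set set" where
  "cyclic_complex n = {\<sigma>. \<sigma> \<noteq> {} \<and> \<sigma> \<subseteq> UNIV \<times> {0..n} \<and> (\<forall>p\<in>\<sigma>. \<forall>q\<in>\<sigma>. \<not> cyclic_conflict n p q) \<and>
     (\<forall>x. \<not> {x} \<times> {0..n} \<subseteq> \<sigma>)}"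

lemma simplicial_cyclic_complex: "simplicial (cyclic_complex n)"
proof (rule simplicialI)
  show "finite \<sigma>" if "\<sigma> \<in> cyclic_complex n" for \<sigma>
    using that finite_subset[of \<sigma> "UNIV \<times> {0..n}"] by (auto simp: cyclic_complex_def)
  fix \<sigma> \<tau> :: "side set" assume "\<sigma> \<in> cyclic_complex n" and \<tau>: "\<tau> \<subseteq> \<sigma>" "\<tau> \<noteq> {}"
  then have \<sigma>: "\<sigma> \<subseteq> UNIV \<times> {0..n}" "\<forall>p\<in>\<sigma>. \<forall>q\<in>\<sigma>. \<not> cyclic_conflict n p q"
    "\<And>x. \<not> {x} \<times> {0..n} \<subseteq> \<sigma>"
    by (simp_all add: cyclic_complex_def)
  have "\<tau> \<subseteq> UNIV \<times> {0..n}" using \<tau>(1) \<sigma>(1) by (rule subset_trans)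
  moreover have "\<forall>p\<in>\<tau>. \<forall>q\<in>\<tau>. \<not> cyclic_conflict n p q" using \<sigma>(2) \<tau>(1) by (meson subsetD)
  moreover have "\<not> {x} \<times> {0..n} \<subseteq> \<tau>" for x using \<sigma>(3)[of x] \<tau>(1) by (metis subset_trans)
  ultimately show "\<tau> \<in> cyclic_complex n" using \<tau>(2) by (simp add: cyclic_complex_def)
qed (simp add: cyclic_complex_def)

lemma complex_fills_cyclic_complex:
  assumes n: "2 \<le> n" and q: "2 * q \<le> n + 1"
  shows "complex_fills q (cyclic_complex n)"
proof (cases "q = 0")
  case False
  let ?K = "cyclic_complex n"
  let ?K1 = "deletion ?K (False, n)"
  have fin: "finite \<sigma>" if "\<sigma> \<subseteq> UNIV \<times> {0..n}" for \<sigma> :: "side set"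
    using finite_subset[OF that] by simp
  have s: "Suc (n - 2) = n - 1" "Suc (n - 1) = n" using n by auto
  \<comment> \<open>The direction is left arbitrary to serve both deletions. Among the sides of the
    other direction, position 0 is lost through the wrap-around, and \<open>n - 1\<close> and
    \<open>n\<close> through ordinary conflicts.\<close>
  have lk: "link ?K (x, n) = indep_avoiding ({x} \<times> {0..n - 1} \<union> {\<not> x} \<times> {1..n - 2}) ({x} \<times> {0..n - 1})"
    (is "_ = indep_avoiding ?W ?Z") for x
  proof (intro set_eqI iffI)
    fix \<sigma> assume "\<sigma> \<in> link ?K (x, n)"
    then have \<sigma>: "(x, n) \<notin> \<sigma>" "\<sigma> \<noteq> {}" "\<sigma> \<subseteq> UNIV \<times> {0..n}"
      and c: "\<And>p q. p \<in> insert (x, n) \<sigma> \<Longrightarrow> q \<in> insert (x, n) \<sigma> \<Longrightarrow> \<not> cyclic_conflict n p q"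
      and f: "\<not> {x} \<times> {0..n} \<subseteq> insert (x, n) \<sigma>"
      by (auto simp: link_def cyclic_complex_def)
    have "(y, i) \<in> ?W" if yi: "(y, i) \<in> \<sigma>" for y i
    proof (cases "y = x")
      case True
      then have "i \<le> n" "i \<noteq> n" using yi \<sigma>(1,3) by auto
      then show ?thesis using True by auto
    next
      case False
      have "i \<le> n" using yi \<sigma>(3) by auto
      moreover have "\<not> cyclic_conflict n (x, n) (y, i)" using c yi by blast
      ultimately have "i \<noteq> 0" "i + 1 < n" using False by (auto simp: cyclic_conflict_def conflict_def)
      then show ?thesis using False by auto
    qed
    then have "\<sigma> \<subseteq> ?W" by (rule subrelI)
    moreover have "\<not> conflict p q" if "p \<in> \<sigma>" "q \<in> \<sigma>" for p q
      using c[of p q] that by (simp add: cyclic_conflict_def)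
    moreover have "\<not> ?Z \<subseteq> \<sigma>"
    proof
      assume Z: "?Z \<subseteq> \<sigma>"
      have "{x} \<times> {0..n} \<subseteq> insert (x, n) ?Z" by auto
      also have "\<dots> \<subseteq> insert (x, n) \<sigma>" using Z by (rule insert_mono)
      finally show False using f by simp
    qed
    ultimately show "\<sigma> \<in> indep_avoiding ?W ?Z"
      using \<sigma>(2) fin[OF \<sigma>(3)] by (simp add: indep_avoiding_def indep_def)
  next
    fix \<sigma> assume "\<sigma> \<in> indep_avoiding ?W ?Z"
    then have \<sigma>: "\<sigma> \<noteq> {}" "\<sigma> \<subseteq> ?W" "\<not> ?Z \<subseteq> \<sigma>"
      and c: "\<And>p q. p \<in> \<sigma> \<Longrightarrow> q \<in> \<sigma> \<Longrightarrow> \<not> conflict p q"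
      by (auto simp: indep_avoiding_def indep_def)
    have W: "y = x \<and> i < n \<or> y \<noteq> x \<and> 0 < i \<and> i + 1 < n" if "(y, i) \<in> \<sigma>" for y i
    proof -
      have "(y, i) \<in> ?W" using \<sigma>(2) that by blast
      then show ?thesis using n by auto
    qed
    have "\<not> cyclic_conflict n p q" if "p \<in> insert (x, n) \<sigma>" "q \<in> insert (x, n) \<sigma>" for p q
      using that W[of "fst p" "snd p"] W[of "fst q" "snd q"] c[of p q]
      by (cases "p = (x, n)"; cases "q = (x, n)") (auto simp: cyclic_conflict_def conflict_def)
    moreover have "insert (x, n) \<sigma> \<subseteq> UNIV \<times> {0..n}" using W by fastforce
    moreover have "\<not> {y} \<times> {0..n} \<subseteq> insert (x, n) \<sigma>" for y
    proof
      assume y: "{y} \<times> {0..n} \<subseteq> insert (x, n) \<sigma>"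
      have "(y, n) \<in> insert (x, n) \<sigma>" by (rule subsetD[OF y]) simp
      then have "y = x" using W[of y n] by auto
      have "?Z \<subseteq> \<sigma>"
      proof
        fix p assume p: "p \<in> ?Z"
        have "p \<in> {y} \<times> {0..n}" using p \<open>y = x\<close> by (cases p) simp
        then have "p \<in> insert (x, n) \<sigma>" by (rule subsetD[OF y])
        moreover have "p \<noteq> (x, n)" using p n by auto
        ultimately show "p \<in> \<sigma>" by simp
      qed
      with \<sigma>(3) show False by simp
    qed
    moreover have "(x, n) \<notin> \<sigma>" using W[of x n] by auto
    ultimately show "\<sigma> \<in> link ?K (x, n)"
      using \<sigma>(1) unfolding link_def cyclic_complex_def by simp
  qed
  \<comment> \<open>\<open>(False, n)\<close> and \<open>(True, n)\<close> conflict, so deleting the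
    former does not affect the link of the latter.\<close>
  have lk1: "link ?K1 (True, n) = link ?K (True, n)"
    by (auto simp: link_def deletion_def cyclic_complex_def cyclic_conflict_def conflict_def)
  \<comment> \<open>With \<open>s = n - 2\<close> and \<open>q - 1\<close> the requirement is
    \<open>2 * (q - 1) \<le> n - 1\<close>, which is again \<open>2 * q \<le> n + 1\<close>.\<close>
  have E: "complex_fills (q - 1) (indep_avoiding ({x} \<times> {0..n - 1} \<union> {\<not> x} \<times> {1..n - 2}) ({x} \<times> {0..n - 1}))" for x
    using complex_fills_unbalanced_strip[of "q - 1" "n - 2" x] s n q False by simp
  \<comment> \<open>Without position \<open>n\<close> there is neither a wrap-around conflict nor a
    full direction, so both additional conditions disappear.\<close>
  have "deletion ?K1 (True, n) = indep (UNIV \<times> {0..<0 + n})"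
  proof (intro set_eqI iffI)
    fix \<sigma> assume "\<sigma> \<in> deletion ?K1 (True, n)"
    then have \<sigma>: "\<And>x. (x, n) \<notin> \<sigma>" "\<sigma> \<noteq> {}" "\<sigma> \<subseteq> UNIV \<times> {0..n}" "\<forall>p\<in>\<sigma>. \<forall>q\<in>\<sigma>. \<not> cyclic_conflict n p q"
      by (auto simp: deletion_def cyclic_complex_def, metis)
    have "(x, i) \<in> UNIV \<times> {0..<n}" if "(x, i) \<in> \<sigma>" for x i
    proof -
      have "i \<noteq> n" using \<sigma>(1)[of x] that by auto
      moreover have "i \<le> n" using \<sigma>(3) that by auto
      ultimately show ?thesis by simp
    qed
    then show "\<sigma> \<in> indep (UNIV \<times> {0..<0 + n})"
      using \<sigma>(2,4) fin[OF \<sigma>(3)] by (auto simp: indep_def cyclic_conflict_def)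
  next
    fix \<sigma> assume "\<sigma> \<in> indep (UNIV \<times> {0..<0 + n})"
    then have \<sigma>: "\<sigma> \<noteq> {}" "\<sigma> \<subseteq> UNIV \<times> {0..<n}" "\<forall>p\<in>\<sigma>. \<forall>q\<in>\<sigma>. \<not> conflict p q"
      by (auto simp: indep_def)
    have nn: "(x, n) \<notin> \<sigma>" for x using \<sigma>(2) by auto
    have "(x, n) \<in> {x} \<times> {0..n}" for x :: bool by simp
    then have "\<not> {x} \<times> {0..n} \<subseteq> \<sigma>" for x using nn[of x] by blast
    moreover have "\<not> cyclic_conflict n p q" if "p \<in> \<sigma>" "q \<in> \<sigma>" for p q
      using \<sigma>(3) that nn[of "fst p"] nn[of "fst q"] by (cases p; cases q) (auto simp: cyclic_conflict_def)
    moreover have "\<sigma> \<subseteq> UNIV \<times> {0..n}" using \<sigma>(2) by auto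
    ultimately show "\<sigma> \<in> deletion ?K1 (True, n)"
      using nn \<sigma>(1) by (simp add: deletion_def cyclic_complex_def)
  qed
  then have "complex_fills q (deletion ?K1 (True, n))"
    using complex_fills_strip[of q n 0] q by simp
  then have "complex_fills q ?K1"
    by (rule fills_deletion_link[OF simplicial_deletion[OF simplicial_cyclic_complex]])
      (use E[of True] lk1 lk[of True] in simp)
  then show ?thesis
    by (rule fills_deletion_link[OF simplicial_cyclic_complex]) (use E[of False] lk[of False] in simp)
qed (simp add: complex_fills_0)

section \<open>Multipaths\<close>

text \<open>The last condition is acyclicity without mention of cycles: it forbids a nonempty set in
  which every arc has a successor. For finite \<open>S\<close> such a set exists exactly if there is
  a directed cycle.\<close>

definition linear_arcs :: "('a \<times> 'a) set \<Rightarrow> bool" where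
  "linear_arcs S \<longleftrightarrow> inj_on fst S \<and> inj_on snd S \<and> (\<forall>T\<subseteq>S. T \<noteq> {} \<longrightarrow> \<not> snd ` T \<subseteq> fst ` T)"

lemma simple_dipath_iff:
  "simple_dipath es \<longleftrightarrow> es \<noteq> [] \<and> successively (\<lambda>e e'. fst e' = snd e) es \<and>
     distinct (map fst es) \<and> distinct (map snd es) \<and> fst (hd es) \<noteq> snd (last es)"
  unfolding simple_dipath_def successively_conv_nth distinct_conv_nth by (auto 4 4)

lemma simple_dipath_nth:
  assumes "simple_dipath es"
  shows "Suc i < length es \<Longrightarrow> fst (es ! Suc i) = snd (es ! i)"
    and "i < length es \<Longrightarrow> j < length es \<Longrightarrow> fst (es ! i) = fst (es ! j) \<Longrightarrow> i = j"
    and "i < length es \<Longrightarrow> j < length es \<Longrightarrow> snd (es ! i) = snd (es ! j) \<Longrightarrow> i = j"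
    and "fst (es ! 0) \<noteq> snd (es ! (length es - 1))" and "es \<noteq> []"
  using assms by (auto simp: simple_dipath_def hd_conv_nth last_conv_nth)

text \<open>Consider the arc of \<open>T\<close> latest on the path, at index \<open>m\<close>, and
  its successor \<open>k\<close> in \<open>T\<close>. If \<open>m\<close> is not the end of the
  path, then \<open>k = Suc m\<close> is later. Otherwise \<open>k = 0\<close> would close the path,
  and for \<open>k > 0\<close> the arc before \<open>k\<close> has the same target as
  \<open>m\<close>, so \<open>k = Suc m\<close> again.\<close>

lemma simple_dipath_no_cycle:
  assumes es: "simple_dipath es" and T: "T \<subseteq> set es" "T \<noteq> {}"
  shows "\<not> snd ` T \<subseteq> fst ` T"
proof
  assume cl: "snd ` T \<subseteq> fst ` T"
  define I where "I = {i. i < length es \<and> es ! i \<in> T}"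
  have "finite I" by (simp add: I_def)
  have "I \<noteq> {}" using T by (force simp: I_def in_set_conv_nth)
  define m where "m = Max I"
  have m: "m \<in> I" "\<And>k. k \<in> I \<Longrightarrow> k \<le> m"
    using \<open>finite I\<close> \<open>I \<noteq> {}\<close> by (auto simp: m_def)
  then have "snd (es ! m) \<in> fst ` T" using cl by (auto simp: I_def)
  then obtain e where e: "e \<in> T" "snd (es ! m) = fst e" by auto
  then obtain k where k: "k < length es" "es ! k = e" using T(1) by (metis in_set_conv_nth subsetD)
  then have kI: "k \<in> I" using e by (simp add: I_def)
  have ml: "m < length es" using m(1) by (simp add: I_def)
  show False
  proof (cases "Suc m < length es")
    case True
    have "k = Suc m"
      using simple_dipath_nth(1)[OF es True] simple_dipath_nth(2)[OF es k(1) True] e k by simp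
    then show False using m(2)[OF kI] by simp
  next
    case False
    then have last: "m = length es - 1" using ml by simp
    show False
    proof (cases k)
      case 0
      then show False using simple_dipath_nth(4)[OF es] e k last by simp
    next
      case (Suc l)
      then have "snd (es ! l) = snd (es ! m)"
        using simple_dipath_nth(1)[OF es, of l] e k by simp
      then have "l = m" using simple_dipath_nth(3)[OF es _ ml, of l] k Suc by simp
      then show False using m(2)[OF kI] Suc by simp
    qed
  qed
qed

text \<open>A longest path in \<open>T\<close> works. An arc outside it that touches it cannot share
  a source or a target with one of its arcs, so it is attached at one of the two ends, and then
  either lengthens the path or closes it to a cycle; both are excluded.\<close>

lemma maximal_simple_dipath:
  assumes fin: "finite T" and ne: "T \<noteq> {}" and T: "linear_arcs T"
  obtains es where "simple_dipath es" "set es \<subseteq> T"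
    "\<And>e. e \<in> T \<Longrightarrow> fst e \<in> fst ` set es \<union> snd ` set es \<or> snd e \<in> fst ` set es \<union> snd ` set es \<Longrightarrow> e \<in> set es"
proof -
  have no_cycle: "\<not> snd ` U \<subseteq> fst ` U" if "U \<subseteq> T" "U \<noteq> {}" for U
    using T that by (simp add: linear_arcs_def)
  have inj: "inj_on fst T" "inj_on snd T" using T by (auto simp: linear_arcs_def)
  let ?P = "\<lambda>es. simple_dipath es \<and> set es \<subseteq> T"
  obtain e0 where "e0 \<in> T" using ne by blast
  moreover from this have "fst e0 \<noteq> snd e0" using no_cycle[of "{e0}"] by auto
  ultimately have "?P [e0]" by (simp add: simple_dipath_iff)
  moreover have "length es \<le> card T" if "?P es" for es
  proof -
    have "distinct es" using that by (simp add: simple_dipath_iff distinct_map)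
    then show ?thesis using that card_mono[OF fin, of "set es"] by (simp add: distinct_card)
  qed
  ultimately obtain es where es: "?P es" and max: "\<And>es'. ?P es' \<Longrightarrow> length es' \<le> length es"
    using ex_has_greatest_nat[of ?P "[e0]" length "Suc (card T)"] by (auto simp: less_Suc_eq_le)
  have dp: "simple_dipath es" and sub: "set es \<subseteq> T" using es by auto
  have nempty: "es \<noteq> []" using simple_dipath_nth(5)[OF dp] .
  let ?V = "fst ` set es \<union> snd ` set es"
  have step: "snd (es ! i) \<in> fst ` set es" if "Suc i < length es" for i
    using simple_dipath_nth(1)[OF dp that] that by (metis imageI nth_mem)
  have step': "fst (es ! i) \<in> snd ` set es" if "i < length es" "0 < i" for i
    using simple_dipath_nth(1)[OF dp, of "i - 1"] that
    by (metis One_nat_def Suc_diff_1 imageI less_imp_diff_less nth_mem)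
  have snd_last: "x = snd (last es)" if x: "x \<in> snd ` set es" "x \<notin> fst ` set es" for x
  proof -
    obtain i where i: "i < length es" "x = snd (es ! i)" using x(1) by (auto simp: in_set_conv_nth)
    then have "\<not> Suc i < length es" using step[of i] x(2) by auto
    then have "i = length es - 1" using i by simp
    then show ?thesis using i nempty by (simp add: last_conv_nth)
  qed
  have fst_hd: "x = fst (hd es)" if x: "x \<in> fst ` set es" "x \<notin> snd ` set es" for x
  proof -
    obtain i where i: "i < length es" "x = fst (es ! i)" using x(1) by (auto simp: in_set_conv_nth)
    then have "i = 0" using step'[of i] x(2) by auto
    then show ?thesis using i nempty by (simp add: hd_conv_nth)
  qed
  have closing: False if e: "e \<in> T" "fst e = snd (last es)" "snd e = fst (hd es)" for e
  proof -
    have "snd ` insert e (set es) \<subseteq> fst ` insert e (set es)"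
    proof
      fix x assume "x \<in> snd ` insert e (set es)"
      then consider "x = snd e" | "x \<in> snd ` set es" by blast
      then show "x \<in> fst ` insert e (set es)"
      proof cases
        case 1
        then show ?thesis using e(3) hd_in_set[OF nempty] by simp
      next
        case 2
        then show ?thesis using snd_last[OF 2] e(2) by (cases "x \<in> fst ` set es") simp_all
      qed
    qed
    moreover have "insert e (set es) \<subseteq> T" using e(1) sub by auto
    ultimately show False using no_cycle by blast
  qed
  have "e \<in> set es" if e: "e \<in> T" "fst e \<in> ?V \<or> snd e \<in> ?V" for e
  proof (rule ccontr)
    assume n: "e \<notin> set es"
    have nf: "fst e \<notin> fst ` set es"
    proof
      assume "fst e \<in> fst ` set es"
      then obtain e' where e': "e' \<in> set es" "fst e = fst e'" by blast
      then have "e = e'" using inj_onD[OF inj(1) e'(2) e(1)] sub by blast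
      then show False using n e'(1) by simp
    qed
    have ns: "snd e \<notin> snd ` set es"
    proof
      assume "snd e \<in> snd ` set es"
      then obtain e' where e': "e' \<in> set es" "snd e = snd e'" by blast
      then have "e = e'" using inj_onD[OF inj(2) e'(2) e(1)] sub by blast
      then show False using n e'(1) by simp
    qed
    consider "fst e \<in> snd ` set es" | "snd e \<in> fst ` set es" using e(2) nf ns by blast
    then show False
    proof cases
      case 1
      then have f: "fst e = snd (last es)" using snd_last nf by blast
      have "fst (hd es) \<noteq> snd e" using closing e(1) f by metis
      then have "?P (es @ [e])"
        using dp nf ns f sub e(1) by (auto simp: simple_dipath_iff successively_append_iff)
      then show False using max[of "es @ [e]"] by simp
    next
      case 2
      then have s: "snd e = fst (hd es)" using fst_hd ns by blast
      have "fst e \<noteq> snd (last es)" using closing e(1) s by metis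
      then have "?P (e # es)"
        using dp nf ns s sub e(1) nempty by (auto simp: simple_dipath_iff successively_Cons)
      then show False using max[of "e # es"] by simp
    qed
  qed
  with dp sub that show ?thesis by blast
qed

text \<open>Connectedness is handled through vertex sets that no arc leaves or enters, which avoids walks
  in the symmetric closure.\<close>

definition arc_closed :: "('a, 'a \<times> 'a) pre_digraph \<Rightarrow> 'a set \<Rightarrow> bool" where
  "arc_closed G W \<longleftrightarrow> (\<forall>e\<in>arcs G. fst e \<in> W \<longleftrightarrow> snd e \<in> W)"

text \<open>A walk in the symmetric closure never leaves a closed set, so in a connected digraph a
  nonempty closed set is everything. Conversely the vertices reachable from \<open>u\<close> form a
  nonempty closed set.\<close>

lemma connected_arc_closed:
  assumes C: "wf_digraph C" "tail C = fst" "head C = snd"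
  shows "Digraph_Component.connected C \<longleftrightarrow>
    verts C \<noteq> {} \<and> (\<forall>W\<subseteq>verts C. W \<noteq> {} \<and> arc_closed C W \<longrightarrow> W = verts C)" (is "?L \<longleftrightarrow> ?R")
proof -
  let ?S = "with_proj (mk_symmetric C)"
  have ends: "(u, v) \<in> arcs_ends ?S \<longleftrightarrow> (u, v) \<in> arcs C \<or> (v, u) \<in> arcs C" for u v
  proof -
    have "arcs_ends ?S = parcs (mk_symmetric C)" by (simp add: arcs_ends_def arc_to_ends_def)
    also have "\<dots> = (\<Union>e\<in>arcs C. {e, prod.swap e})"
      using C(2,3) by (simp add: mk_symmetric_def prod.swap_def)
    finally show ?thesis by (auto intro: bexI[of _ "(v, u)"])
  qed
  have vs: "verts ?S = verts C" by (simp add: mk_symmetric_def)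
  have wf: "fst e \<in> verts C \<and> snd e \<in> verts C" if "e \<in> arcs C" for e
    using wf_digraph.tail_in_verts[OF C(1) that] wf_digraph.head_in_verts[OF C(1) that] C by simp
  have reach_closed: "v \<in> W" if "u \<rightarrow>\<^sup>*\<^bsub>?S\<^esub> v" "u \<in> W" "arc_closed C W" for u v W
    using that(1) unfolding reachable_def
    by (induction rule: rtrancl_on_induct) (use that ends in \<open>auto simp: arc_closed_def\<close>)
  show ?thesis
  proof
    assume ?L
    then have "verts C \<noteq> {}" "\<And>u v. u \<in> verts C \<Longrightarrow> v \<in> verts C \<Longrightarrow> u \<rightarrow>\<^sup>*\<^bsub>?S\<^esub> v"
      unfolding connected_def strongly_connected_def vs by blast+
    then show ?R using reach_closed by blast
  next
    assume R: ?R
    have R': "W = verts C" if "W \<subseteq> verts C" "W \<noteq> {}" "arc_closed C W" for W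
      using R that by simp
    have "u \<rightarrow>\<^sup>*\<^bsub>?S\<^esub> v" if u: "u \<in> verts C" "v \<in> verts C" for u v
    proof -
      let ?W = "{w \<in> verts C. u \<rightarrow>\<^sup>*\<^bsub>?S\<^esub> w}"
      have uW: "u \<in> ?W" using u vs by (simp add: reachable_def)
      have step: "b \<in> ?W" if "a \<in> ?W" "(a, b) \<in> arcs C \<or> (b, a) \<in> arcs C" for a b
      proof -
        have "b \<in> verts C" using that(2) wf by fastforce
        moreover have "u \<rightarrow>\<^sup>*\<^bsub>?S\<^esub> b"
          using that ends \<open>b \<in> verts C\<close> vs unfolding reachable_def
          by (auto intro: rtrancl_on_into_rtrancl_on)
        ultimately show ?thesis by simp
      qed
      have "fst e \<in> ?W \<longleftrightarrow> snd e \<in> ?W" if "e \<in> arcs C" for e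
      proof -
        have e: "(fst e, snd e) \<in> arcs C" using that by simp
        show ?thesis
        proof
          show "snd e \<in> ?W" if "fst e \<in> ?W" by (rule step[OF that disjI1[OF e]])
          show "fst e \<in> ?W" if "snd e \<in> ?W" by (rule step[OF that disjI2[OF e]])
        qed
      qed
      then have "arc_closed C ?W" by (simp add: arc_closed_def)
      then have "?W = verts C" by (intro R') (use uW in auto)
      then show ?thesis using u by blast
    qed
    then show ?L using R unfolding connected_def strongly_connected_def vs by blast
  qed
qed

section \<open>Components and their arcs\<close>

lemma component_of_iff:
  "component_of C (with_proj H) \<longleftrightarrow>
    subgraph C (with_proj H) \<and> Digraph_Component.connected C \<and>
    (\<forall>C'. subgraph C' (with_proj H) \<and> Digraph_Component.connected C' \<and> subgraph C C' \<longrightarrow> C' = C)"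
  unfolding component_of_def pre_digraph.max_subgraph_def by blast

lemma subgraph_with_projD:
  assumes "subgraph C (with_proj H)"
  shows "wf_digraph C" "tail C = fst" "head C = snd" "verts C \<subseteq> pverts H" "arcs C \<subseteq> parcs H"
  using assms by (auto simp: subgraph_def compatible_def)

text \<open>Adding \<open>e\<close> and its ends to \<open>C\<close> gives a connected subgraph: a
  closed set meets \<open>C\<close> in nothing or in all of \<open>C\<close>, and \<open>e\<close>
  links its new end to \<open>C\<close>. Maximality then forces \<open>e\<close> into
  \<open>C\<close>.\<close>

lemma component_arc:
  assumes H: "wf_digraph (with_proj H)" and C: "component_of C (with_proj H)"
    and e: "e \<in> parcs H" "fst e \<in> verts C \<or> snd e \<in> verts C"
  shows "e \<in> arcs C"
proof -
  have sub: "subgraph C (with_proj H)" and con: "Digraph_Component.connected C"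
    using C by (auto simp: component_of_iff)
  note C' = subgraph_with_projD[OF sub]
  define D where "D = \<lparr>verts = verts C \<union> {fst e, snd e}, arcs = insert e (arcs C), tail = fst, head = snd\<rparr>"
  have eH: "fst e \<in> pverts H" "snd e \<in> pverts H"
    using wf_digraph.tail_in_verts[OF H, of e] wf_digraph.head_in_verts[OF H, of e] e by auto
  have wfC: "fst a \<in> verts C \<and> snd a \<in> verts C" if "a \<in> arcs C" for a
    using wf_digraph.tail_in_verts[OF C'(1) that] wf_digraph.head_in_verts[OF C'(1) that] C'(2,3) by simp
  have wfD: "wf_digraph D"
    by unfold_locales (use wfC in \<open>auto simp: D_def\<close>)
  have "subgraph D (with_proj H)"
    unfolding subgraph_def using wfD H C'(4,5) eH e(1) by (auto simp: D_def compatible_def)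
  moreover have "Digraph_Component.connected D"
  proof (subst connected_arc_closed[OF wfD])
    show "tail D = fst" "head D = snd" by (simp_all add: D_def)
    have conC: "verts C \<noteq> {}" "\<And>W. W \<subseteq> verts C \<Longrightarrow> W \<noteq> {} \<Longrightarrow> arc_closed C W \<Longrightarrow> W = verts C"
      using con connected_arc_closed[OF C'(1-3)] by auto
    have "W = verts D" if W: "W \<subseteq> verts D" "W \<noteq> {}" "arc_closed D W" for W
    proof -
      have cl: "fst e \<in> W \<longleftrightarrow> snd e \<in> W" using W(3) by (simp add: arc_closed_def D_def)
      have "arc_closed C (W \<inter> verts C)"
        using W(3) wfC by (auto simp: arc_closed_def D_def)
      then consider "W \<inter> verts C = {}" | "W \<inter> verts C = verts C" using conC(2) by blast
      then show ?thesis
      proof cases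
        case 1
        then show ?thesis using W(1,2) cl e(2) by (auto simp: D_def)
      next
        case 2
        then have "fst e \<in> W" "snd e \<in> W" using e(2) cl by auto
        then show ?thesis using 2 W(1) by (auto simp: D_def)
      qed
    qed
    then show "verts D \<noteq> {} \<and> (\<forall>W\<subseteq>verts D. W \<noteq> {} \<and> arc_closed D W \<longrightarrow> W = verts D)"
      by (auto simp: D_def)
  qed
  moreover have "subgraph C D"
    unfolding subgraph_def using wfD C' by (auto simp: D_def compatible_def)
  ultimately have "D = C" using C by (auto simp: component_of_iff)
  then have "arcs C = insert e (arcs C)" by (metis D_def pre_digraph.select_convs(2))
  then show ?thesis by blast
qed

text \<open>The vertex set is the least closed set \<open>W\<close> containing \<open>v\<close>. It
  is connected: a closed \<open>U \<subseteq> W\<close> containing \<open>v\<close> is all of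
  \<open>W\<close>, and otherwise \<open>W - U\<close> is a closed set containing \<open>v\<close>,
  so that \<open>U\<close> is empty.\<close>

lemma component_exists:
  assumes H: "wf_digraph (with_proj H)" and v: "v \<in> pverts H"
  obtains C where "component_of C (with_proj H)" "v \<in> verts C"
proof -
  let ?G = "with_proj H"
  define W where "W = \<Inter>{W. W \<subseteq> pverts H \<and> v \<in> W \<and> arc_closed ?G W}"
  have wfH: "fst a \<in> pverts H \<and> snd a \<in> pverts H" if "a \<in> parcs H" for a
    using wf_digraph.tail_in_verts[OF H, of a] wf_digraph.head_in_verts[OF H, of a] that by simp
  have "arc_closed ?G (pverts H)" using wfH by (simp add: arc_closed_def)
  then have WH: "W \<subseteq> pverts H" using v by (auto simp: W_def)
  have vW: "v \<in> W" by (simp add: W_def)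
  have clW: "arc_closed ?G W" by (auto simp: W_def arc_closed_def)
  have least: "W \<subseteq> U" if "U \<subseteq> pverts H" "v \<in> U" "arc_closed ?G U" for U
    using that by (auto simp: W_def)
  define C where "C = \<lparr>verts = W, arcs = {e \<in> parcs H. fst e \<in> W}, tail = fst, head = snd\<rparr>"
  have clW': "fst e \<in> W \<longleftrightarrow> snd e \<in> W" if "e \<in> parcs H" for e
    using clW that by (simp add: arc_closed_def)
  have wfC: "wf_digraph C"
    by unfold_locales (use clW' in \<open>auto simp: C_def\<close>)
  have tC: "tail C = fst" "head C = snd" by (simp_all add: C_def)
  have subC: "subgraph C ?G"
    unfolding subgraph_def using wfC H WH by (auto simp: C_def compatible_def)
  have "U = verts C" if U: "U \<subseteq> verts C" "U \<noteq> {}" "arc_closed C U" for U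
  proof -
    have UW: "U \<subseteq> W" using U(1) by (simp add: C_def)
    have U': "fst e \<in> U \<longleftrightarrow> snd e \<in> U" if "e \<in> parcs H" for e
    proof (cases "fst e \<in> W")
      case True
      then have "e \<in> arcs C" using that by (simp add: C_def)
      then show ?thesis using U(3) by (simp add: arc_closed_def)
    next
      case False
      then show ?thesis using UW clW'[OF that] by blast
    qed
    show ?thesis
    proof (cases "v \<in> U")
      case True
      have "W \<subseteq> U" by (rule least) (use UW WH True U' in \<open>auto simp: arc_closed_def\<close>)
      then show ?thesis using UW by (simp add: C_def)
    next
      case False
      have "W \<subseteq> W - U" by (rule least) (use WH vW False U' clW' in \<open>auto simp: arc_closed_def\<close>)
      then show ?thesis using UW U(2) by blast
    qed
  qed
  then have con: "Digraph_Component.connected C"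
    unfolding connected_arc_closed[OF wfC tC] using vW by (auto simp: C_def)
  have "C' = C" if C': "subgraph C' ?G" "Digraph_Component.connected C'" "subgraph C C'" for C'
  proof -
    note D = subgraph_with_projD[OF C'(1)]
    have "verts C \<subseteq> verts C'" "arcs C \<subseteq> arcs C'" using C'(3) by (auto simp: subgraph_def)
    moreover have "arc_closed C' W" using clW' D(5) by (auto simp: arc_closed_def)
    ultimately have W: "W = verts C'"
      using C'(2) vW unfolding connected_arc_closed[OF D(1-3)] by (auto simp: C_def)
    have "arcs C' \<subseteq> arcs C"
      using D(5) wf_digraph.tail_in_verts[OF D(1)] W D(2) by (auto simp: C_def)
    then show ?thesis using W \<open>arcs C \<subseteq> arcs C'\<close> D(2,3) by (auto simp: C_def)
  qed
  then have "component_of C ?G" using subC con by (auto simp: component_of_iff)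
  with that vW show ?thesis by (auto simp: C_def)
qed

text \<open>Arcs sharing an end lie in one component, hence on one path, where sources and targets
  are distinct. A set \<open>T\<close> closed under successors stays so after intersection with the
  arcs of one component, which contradicts \<open>simple_dipath_no_cycle\<close>.\<close>

lemma multipath_linear_arcs:
  assumes H: "wf_digraph (with_proj H)"
    and comp: "\<And>C. component_of C (with_proj H) \<Longrightarrow> is_single_vertex C \<or> is_simple_dipath C"
  shows "linear_arcs (parcs H)"
proof -
  have wfH: "fst a \<in> pverts H \<and> snd a \<in> pverts H" if "a \<in> parcs H" for a
    using wf_digraph.tail_in_verts[OF H, of a] wf_digraph.head_in_verts[OF H, of a] that by simp
  have path: "\<exists>es. simple_dipath es \<and> (\<forall>e\<in>parcs H. fst e \<in> verts C \<or> snd e \<in> verts C \<longrightarrow> e \<in> set es) \<and> set es = arcs C"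
    if C: "component_of C (with_proj H)" and a: "a \<in> parcs H" "fst a \<in> verts C \<or> snd a \<in> verts C" for C a
  proof -
    have "a \<in> arcs C" by (rule component_arc[OF H C a])
    then have "is_simple_dipath C" using comp[OF C] by (auto simp: is_single_vertex_def)
    then obtain es where es: "simple_dipath es" "arcs C = set es" by (auto simp: is_simple_dipath_def)
    have "\<forall>e\<in>parcs H. fst e \<in> verts C \<or> snd e \<in> verts C \<longrightarrow> e \<in> set es"
      using component_arc[OF H C] es(2) by simp
    then show ?thesis using es by blast
  qed
  have "inj_on fst (parcs H)"
  proof (rule inj_onI)
    fix a b assume ab: "a \<in> parcs H" "b \<in> parcs H" "fst a = fst b"
    obtain C where C: "component_of C (with_proj H)" "fst a \<in> verts C"
      using component_exists[OF H] wfH[OF ab(1)] by blast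
    obtain es where "simple_dipath es" "a \<in> set es" "b \<in> set es"
      using path[OF C(1) ab(1)] C(2) ab by auto
    then show "a = b" using ab(3) simple_dipath_nth(2) by (metis in_set_conv_nth)
  qed
  moreover have "inj_on snd (parcs H)"
  proof (rule inj_onI)
    fix a b assume ab: "a \<in> parcs H" "b \<in> parcs H" "snd a = snd b"
    obtain C where C: "component_of C (with_proj H)" "snd a \<in> verts C"
      using component_exists[OF H] wfH[OF ab(1)] by blast
    obtain es where "simple_dipath es" "a \<in> set es" "b \<in> set es"
      using path[OF C(1) ab(1)] C(2) ab by auto
    then show "a = b" using ab(3) simple_dipath_nth(3) by (metis in_set_conv_nth)
  qed
  moreover have "\<not> snd ` T \<subseteq> fst ` T" if T: "T \<subseteq> parcs H" "T \<noteq> {}" for T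
  proof
    assume cyc: "snd ` T \<subseteq> fst ` T"
    obtain a where a: "a \<in> T" using T(2) by blast
    then have aH: "a \<in> parcs H" using T(1) by blast
    obtain C where C: "component_of C (with_proj H)" "fst a \<in> verts C"
      using component_exists[OF H] wfH[OF aH] by blast
    obtain es where es: "simple_dipath es" "\<And>e. e \<in> parcs H \<Longrightarrow> fst e \<in> verts C \<Longrightarrow> e \<in> set es" "set es = arcs C"
      using path[OF C(1) aH] C(2) by auto
    have sub: "subgraph C (with_proj H)" using C(1) by (simp add: component_of_iff)
    note D = subgraph_with_projD[OF sub]
    have sv: "snd e \<in> verts C" if "e \<in> arcs C" for e
      using wf_digraph.head_in_verts[OF D(1) that] D(3) by simp
    have "snd ` (T \<inter> arcs C) \<subseteq> fst ` (T \<inter> arcs C)"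
    proof
      fix x assume "x \<in> snd ` (T \<inter> arcs C)"
      then obtain e where e: "e \<in> T" "e \<in> arcs C" "x = snd e" by blast
      then obtain e' where e': "e' \<in> T" "snd e = fst e'" using cyc by blast
      then have "e' \<in> arcs C" using es(2)[of e'] es(3) sv[OF e(2)] T(1) by auto
      then show "x \<in> fst ` (T \<inter> arcs C)" using e e' by auto
    qed
    moreover have "a \<in> T \<inter> arcs C" using a es(2)[OF aH C(2)] es(3) by simp
    ultimately show False using simple_dipath_no_cycle[OF es(1), of "T \<inter> arcs C"] es(3) by auto
  qed
  ultimately show ?thesis by (simp add: linear_arcs_def)
qed

text \<open>If \<open>C\<close> has no arcs, every single vertex is closed. Otherwise the vertex set
  of a maximal path in \<open>C\<close> is closed, so by connectedness the path exhausts
  \<open>C\<close>.\<close>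

lemma linear_arcs_component:
  assumes H: "wf_digraph (with_proj H)" and fin: "finite (parcs H)" and lin: "linear_arcs (parcs H)"
    and C: "component_of C (with_proj H)"
  shows "is_single_vertex C \<or> is_simple_dipath C"
proof -
  have sub: "subgraph C (with_proj H)" and con: "Digraph_Component.connected C"
    using C by (auto simp: component_of_iff)
  note D = subgraph_with_projD[OF sub]
  have ne: "verts C \<noteq> {}" and cl: "\<And>W. W \<subseteq> verts C \<Longrightarrow> W \<noteq> {} \<Longrightarrow> arc_closed C W \<Longrightarrow> W = verts C"
    using con connected_arc_closed[OF D(1-3)] by auto
  have wfC: "fst a \<in> verts C \<and> snd a \<in> verts C" if "a \<in> arcs C" for a
    using wf_digraph.tail_in_verts[OF D(1) that] wf_digraph.head_in_verts[OF D(1) that] D(2,3) by simp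
  show ?thesis
  proof (cases "arcs C = {}")
    case True
    obtain v where "v \<in> verts C" using ne by blast
    then have "{v} = verts C" using cl[of "{v}"] True by (auto simp: arc_closed_def)
    then show ?thesis using True by (auto simp: is_single_vertex_def)
  next
    case False
    have "finite (arcs C)" using D(5) fin by (rule finite_subset)
    moreover have "linear_arcs (arcs C)"
      using lin D(5) unfolding linear_arcs_def by (meson inj_on_subset subset_trans)
    ultimately obtain es where es: "simple_dipath es" "set es \<subseteq> arcs C"
      "\<And>e. e \<in> arcs C \<Longrightarrow> fst e \<in> fst ` set es \<union> snd ` set es \<or> snd e \<in> fst ` set es \<union> snd ` set es \<Longrightarrow> e \<in> set es"
      using maximal_simple_dipath[OF _ False] by metis
    let ?V = "fst ` set es \<union> snd ` set es"
    have "?V \<noteq> {}" using simple_dipath_nth(5)[OF es(1)] by auto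
    moreover have "?V \<subseteq> verts C" using es(2) wfC by auto
    moreover have "arc_closed C ?V" unfolding arc_closed_def using es(3) by blast
    ultimately have V: "?V = verts C" using cl by blast
    moreover have "arcs C = set es"
    proof
      show "arcs C \<subseteq> set es" using es(3) wfC V by blast
    qed (rule es(2))
    ultimately show ?thesis using es(1) unfolding is_simple_dipath_def by blast
  qed
qed

text \<open>A multipath is spanning and so is determined by its arcs; the condition on components
  turns into the condition \<open>linear_arcs\<close> on the arc set.\<close>

lemma multipath_complex_eq:
  assumes G: "wf_digraph (with_proj G)" and fin: "finite (parcs G)"
  shows "multipath_complex G = {S. S \<noteq> {} \<and> S \<subseteq> parcs G \<and> linear_arcs S}"
proof (intro set_eqI iffI)
  fix S assume "S \<in> multipath_complex G"
  then obtain H where H: "S = parcs H" "multipath H G" "S \<noteq> {}" by (auto simp: multipath_complex_def)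
  then have sub: "subgraph (with_proj H) (with_proj G)" by (auto simp: multipath_def spanning_def)
  have "linear_arcs (parcs H)"
    by (rule multipath_linear_arcs) (use H sub in \<open>auto simp: multipath_def subgraph_def\<close>)
  then show "S \<in> {S. S \<noteq> {} \<and> S \<subseteq> parcs G \<and> linear_arcs S}"
    using H sub by (auto simp: subgraph_def)
next
  fix S assume "S \<in> {S. S \<noteq> {} \<and> S \<subseteq> parcs G \<and> linear_arcs S}"
  then have S: "S \<noteq> {}" "S \<subseteq> parcs G" "linear_arcs S" by auto
  define H where "H = \<lparr>pverts = pverts G, parcs = S\<rparr>"
  have wfH: "wf_digraph (with_proj H)"
    using wf_digraph.tail_in_verts[OF G] wf_digraph.head_in_verts[OF G] S(2)
    by unfold_locales (auto simp: H_def)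
  have "spanning (with_proj H) (with_proj G)"
    using S(2) wfH G by (auto simp: spanning_def subgraph_def H_def)
  moreover have "is_single_vertex C \<or> is_simple_dipath C" if "component_of C (with_proj H)" for C
    by (rule linear_arcs_component[OF wfH _ _ that])
      (use S finite_subset[OF S(2) fin] in \<open>auto simp: H_def\<close>)
  ultimately have "multipath H G" by (simp add: multipath_def)
  moreover have "S = parcs H" by (simp add: H_def)
  ultimately show "S \<in> multipath_complex G" using S(1) unfolding multipath_complex_def by blast
qed

section \<open>The bidirectional polygonal digraph\<close>

definition next_vertex :: "nat \<Rightarrow> nat \<Rightarrow> nat" where
  "next_vertex n i = (i + 1) mod (n + 1)"

definition polygon_arc :: "nat \<Rightarrow> side \<Rightarrow> nat \<times> nat" where
  "polygon_arc n p = (if fst p then (snd p, next_vertex n (snd p)) else (next_vertex n (snd p), snd p))"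

lemma next_vertex_eq: "i \<le> n \<Longrightarrow> next_vertex n i = (if i = n then 0 else i + 1)"
  by (simp add: next_vertex_def)

lemma next_vertex_inj: "i \<le> n \<Longrightarrow> j \<le> n \<Longrightarrow> next_vertex n i = next_vertex n j \<Longrightarrow> i = j"
  by (simp add: next_vertex_eq split: if_splits)

lemma next_vertex_le: "next_vertex n i \<le> n"
  by (simp add: next_vertex_def less_Suc_eq_le[symmetric])

lemma next_vertex_surj:
  assumes "i \<le> n"
  obtains j where "j \<le> n" "next_vertex n j = i"
proof (cases i)
  case 0
  then show ?thesis using that[of n] by (simp add: next_vertex_eq)
next
  case (Suc j)
  then show ?thesis using that[of j] assms by (simp add: next_vertex_eq)
qed

text \<open>Induction around the cycle: from \<open>i\<close> up to \<open>n\<close>, across to 0,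
  and up again. Passing to the complement gives the backward version
  \<open>prev_vertex_closed\<close>.\<close>

lemma next_vertex_closed:
  assumes ne: "i \<in> A" "i \<le> n" and closed: "\<And>i. i \<in> A \<Longrightarrow> i \<le> n \<Longrightarrow> next_vertex n i \<in> A"
  shows "{0..n} \<subseteq> A"
proof -
  have up: "i + k \<in> A" if "i \<in> A" "i + k \<le> n" for i k
    using that(2)
  proof (induction k)
    case (Suc k)
    then show ?case using closed[of "i + k"] by (simp add: next_vertex_eq)
  qed (use that in simp)
  have "n \<in> A" using up[OF ne(1), of "n - i"] ne(2) by simp
  then have "0 \<in> A" using closed[of n] by (simp add: next_vertex_eq)
  then show ?thesis using up[of 0] by auto
qed

lemma prev_vertex_closed:
  assumes ne: "i \<in> A" "i \<le> n" and closed: "\<And>i. i \<le> n \<Longrightarrow> next_vertex n i \<in> A \<Longrightarrow> i \<in> A"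
  shows "{0..n} \<subseteq> A"
proof (rule ccontr)
  assume "\<not> {0..n} \<subseteq> A"
  then obtain j where j: "j \<in> - A" "j \<le> n"
    by (metis ComplI atLeastAtMost_iff subsetI)
  have "{0..n} \<subseteq> - A"
    by (rule next_vertex_closed[OF j]) (use closed in auto)
  with ne show False by auto
qed

text \<open>This needs \<open>n \<ge> 2\<close>: for \<open>n = 1\<close> the sides
  \<open>(True, 0)\<close> and \<open>(False, 1)\<close> are the same arc from 0 to 1.\<close>

lemma inj_polygon_arc:
  assumes "n \<ge> 2"
  shows "inj_on (polygon_arc n) (UNIV \<times> {0..n})"
proof (rule inj_onI)
  fix p q :: side assume "p \<in> UNIV \<times> {0..n}" "q \<in> UNIV \<times> {0..n}" and eq: "polygon_arc n p = polygon_arc n q"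
  then have "snd p \<le> n" "snd q \<le> n" by auto
  then show "p = q" using eq assms
    by (cases p; cases q) (auto simp: polygon_arc_def next_vertex_eq split: if_splits)
qed

lemma cyclic_conflict_iff:
  assumes "snd p \<le> n" "snd q \<le> n"
  shows "cyclic_conflict n p q \<longleftrightarrow>
    fst p \<noteq> fst q \<and> (snd p = snd q \<or> snd q = next_vertex n (snd p) \<or> snd p = next_vertex n (snd q))"
  using assms unfolding cyclic_conflict_def conflict_def by (auto simp: next_vertex_eq)

lemma parcs_BP: "parcs (BP n) = polygon_arc n ` (UNIV \<times> {0..n})"
proof -
  have "polygon_arc n ` (UNIV \<times> {0..n}) = (\<Union>i\<in>{0..n}. {polygon_arc n (True, i), polygon_arc n (False, i)})"
    by (auto simp: UNIV_bool)
  then show ?thesis by (simp add: BP_def polygon_arc_def next_vertex_def)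
qed

text \<open>Opposite sides at the same position form a directed cycle of length 2; at adjacent
  positions they share a target or a source. The remaining way to violate \<open>linear_arcs\<close>
  is a cycle that never changes direction, and this one goes around the whole polygon.\<close>

lemma linear_polygon_arcs:
  assumes n: "n \<ge> 2" and \<sigma>: "\<sigma> \<subseteq> UNIV \<times> {0..n}"
  shows "linear_arcs (polygon_arc n ` \<sigma>) \<longleftrightarrow>
    (\<forall>p\<in>\<sigma>. \<forall>q\<in>\<sigma>. \<not> cyclic_conflict n p q) \<and> (\<forall>x. \<not> {x} \<times> {0..n} \<subseteq> \<sigma>)" (is "?L \<longleftrightarrow> ?R")
proof
  assume L: ?L
  have inj: "inj_on fst (polygon_arc n ` \<sigma>)" "inj_on snd (polygon_arc n ` \<sigma>)"
    and nc: "\<And>T. T \<subseteq> polygon_arc n ` \<sigma> \<Longrightarrow> T \<noteq> {} \<Longrightarrow> \<not> snd ` T \<subseteq> fst ` T"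
    using L by (auto simp: linear_arcs_def)
  have no: False if ij: "(True, i) \<in> \<sigma>" "(False, j) \<in> \<sigma>"
    and c: "i = j \<or> j = next_vertex n i \<or> i = next_vertex n j" for i j
  proof -
    have mem: "(True, i) \<in> UNIV \<times> {0..n}" "(False, j) \<in> UNIV \<times> {0..n}" using ij \<sigma> by auto
    have ne: "polygon_arc n (True, i) \<noteq> polygon_arc n (False, j)"
      using inj_onD[OF inj_polygon_arc[OF n] _ mem] by auto
    have im: "polygon_arc n (True, i) \<in> polygon_arc n ` \<sigma>" "polygon_arc n (False, j) \<in> polygon_arc n ` \<sigma>"
      using ij by auto
    from c show False
    proof (elim disjE)
      assume "i = j"
      then show False
        using nc[of "{polygon_arc n (True, i), polygon_arc n (False, j)}"] im by (auto simp: polygon_arc_def)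
    next
      assume "j = next_vertex n i"
      then show False using inj_onD[OF inj(2) _ im] ne by (auto simp: polygon_arc_def)
    next
      assume "i = next_vertex n j"
      then show False using inj_onD[OF inj(1) _ im] ne by (auto simp: polygon_arc_def)
    qed
  qed
  have "\<not> cyclic_conflict n p q" if pq: "p \<in> \<sigma>" "q \<in> \<sigma>" for p q
  proof
    assume c: "cyclic_conflict n p q"
    have le: "snd p \<le> n" "snd q \<le> n" using pq \<sigma> by auto
    obtain x i y j where "p = (x, i)" "q = (y, j)" by (metis surj_pair)
    then show False
      using c[unfolded cyclic_conflict_iff[OF le]] no[of i j] no[of j i] pq by (cases x; cases y) auto
  qed
  moreover have "\<not> {x} \<times> {0..n} \<subseteq> \<sigma>" for x
  proof
    assume sub: "{x} \<times> {0..n} \<subseteq> \<sigma>"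
    let ?T = "polygon_arc n ` ({x} \<times> {0..n})"
    have "snd ` ?T \<subseteq> fst ` ?T"
    proof
      fix v assume "v \<in> snd ` ?T"
      then obtain i where i: "i \<le> n" "v = snd (polygon_arc n (x, i))" by auto
      show "v \<in> fst ` ?T"
      proof (cases x)
        case True
        then have "v = fst (polygon_arc n (x, next_vertex n i))" using i by (simp add: polygon_arc_def)
        then show ?thesis using next_vertex_le by auto
      next
        case False
        obtain j where "j \<le> n" "next_vertex n j = i" using next_vertex_surj[OF i(1)] .
        then have "v = fst (polygon_arc n (x, j))" using i False by (simp add: polygon_arc_def)
        then show ?thesis using \<open>j \<le> n\<close> by auto
      qed
    qed
    moreover have "?T \<subseteq> polygon_arc n ` \<sigma>" using sub by (rule image_mono)
    ultimately show False using nc[of ?T] by auto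
  qed
  ultimately show ?R by blast
next
  assume R: ?R
  have le: "i \<le> n" if "(x, i) \<in> \<sigma>" for x i using that \<sigma> by auto
  have no: False if ij: "(True, i) \<in> \<sigma>" "(False, j) \<in> \<sigma>"
    and c: "i = j \<or> j = next_vertex n i \<or> i = next_vertex n j" for i j
    using R ij c cyclic_conflict_iff[of "(True, i)" n "(False, j)"] le[OF ij(1)] le[OF ij(2)] by auto
  have "inj_on fst (polygon_arc n ` \<sigma>)"
  proof (rule inj_onI, elim imageE)
    fix a b p q assume pq: "a = polygon_arc n p" "b = polygon_arc n q" "p \<in> \<sigma>" "q \<in> \<sigma>" "fst a = fst b"
    obtain x i y j where xy: "p = (x, i)" "q = (y, j)" by (cases p; cases q) blast
    have i: "i \<le> n" "j \<le> n" using pq(3,4) xy le by auto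
    have eq: "fst (polygon_arc n (x, i)) = fst (polygon_arc n (y, j))" using pq xy by simp
    consider "x" "y" | "\<not> x" "\<not> y" | "x" "\<not> y" | "\<not> x" "y" by blast
    then have "p = q"
    proof cases
      case 1
      with eq xy show ?thesis by (simp add: polygon_arc_def)
    next
      case 2
      with eq xy next_vertex_inj[OF i] show ?thesis by (simp add: polygon_arc_def)
    next
      case 3
      with eq xy pq(3,4) no[of i j] show ?thesis by (simp add: polygon_arc_def)
    next
      case 4
      with eq xy pq(3,4) no[of j i] show ?thesis by (simp add: polygon_arc_def)
    qed
    then show "a = b" using pq by simp
  qed
  moreover have "inj_on snd (polygon_arc n ` \<sigma>)"
  proof (rule inj_onI, elim imageE)
    fix a b p q assume pq: "a = polygon_arc n p" "b = polygon_arc n q" "p \<in> \<sigma>" "q \<in> \<sigma>" "snd a = snd b"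
    obtain x i y j where xy: "p = (x, i)" "q = (y, j)" by (cases p; cases q) blast
    have i: "i \<le> n" "j \<le> n" using pq(3,4) xy le by auto
    have eq: "snd (polygon_arc n (x, i)) = snd (polygon_arc n (y, j))" using pq xy by simp
    consider "x" "y" | "\<not> x" "\<not> y" | "x" "\<not> y" | "\<not> x" "y" by blast
    then have "p = q"
    proof cases
      case 1
      with eq xy next_vertex_inj[OF i] show ?thesis by (simp add: polygon_arc_def)
    next
      case 2
      with eq xy show ?thesis by (simp add: polygon_arc_def)
    next
      case 3
      with eq xy pq(3,4) no[of i j] show ?thesis by (simp add: polygon_arc_def)
    next
      case 4
      with eq xy pq(3,4) no[of j i] show ?thesis by (simp add: polygon_arc_def)
    qed
    then show "a = b" using pq by simp
  qed
  moreover have "\<not> snd ` T \<subseteq> fst ` T" if T: "T \<subseteq> polygon_arc n ` \<sigma>" "T \<noteq> {}" for T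
  proof
    assume cyc: "snd ` T \<subseteq> fst ` T"
    obtain \<tau> where \<tau>: "\<tau> \<subseteq> \<sigma>" "T = polygon_arc n ` \<tau>" using T(1) by (auto simp: subset_image_iff)
    have succ: "\<exists>q\<in>\<tau>. snd (polygon_arc n p) = fst (polygon_arc n q)" if "p \<in> \<tau>" for p
      using cyc that \<tau>(2) by blast
    obtain x i where xi: "(x, i) \<in> \<tau>" using T(2) \<tau>(2) by auto
    have le\<tau>: "i \<le> n" if "(x, i) \<in> \<tau>" for x i using le that \<tau>(1) by blast
    \<comment> \<open>Without conflicts the successor of an arc has the same direction. Successors
      move to the next position for \<open>True\<close> and to the previous one for
      \<open>False\<close>, so the positions occupied in direction \<open>x\<close> fill the
      cycle.\<close>
    have "{0..n} \<subseteq> {i. (x, i) \<in> \<tau>}"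
    proof (cases x)
      case True
      show ?thesis
      proof (rule next_vertex_closed)
        show "i \<in> {i. (x, i) \<in> \<tau>}" "i \<le> n" using xi le\<tau> by auto
        fix i assume i: "i \<in> {i. (x, i) \<in> \<tau>}" "i \<le> n"
        then obtain y j where q: "(y, j) \<in> \<tau>" "snd (polygon_arc n (x, i)) = fst (polygon_arc n (y, j))"
          using succ by force
        have "y"
        proof (rule ccontr)
          assume "\<not> y"
          then have "i = j" using q(2) True next_vertex_inj[OF i(2) le\<tau>[OF q(1)]] by (simp add: polygon_arc_def)
          then show False using no[of i j] i(1) q(1) \<tau>(1) True \<open>\<not> y\<close> by auto
        qed
        then show "next_vertex n i \<in> {i. (x, i) \<in> \<tau>}" using q True by (simp add: polygon_arc_def)
      qed
    next
      case False
      show ?thesis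
      proof (rule prev_vertex_closed)
        show "i \<in> {i. (x, i) \<in> \<tau>}" "i \<le> n" using xi le\<tau> by auto
        fix i assume i: "i \<le> n" "next_vertex n i \<in> {i. (x, i) \<in> \<tau>}"
        then obtain y j where q: "(y, j) \<in> \<tau>" "snd (polygon_arc n (x, next_vertex n i)) = fst (polygon_arc n (y, j))"
          using succ by force
        have "\<not> y"
        proof
          assume "y"
          then have "next_vertex n i = j" using q(2) False by (simp add: polygon_arc_def)
          then show False using no[of j j] i(2) q(1) \<tau>(1) False \<open>y\<close> by auto
        qed
        then have "i = j" using q(2) False next_vertex_inj[OF i(1) le\<tau>[OF q(1)]] by (simp add: polygon_arc_def)
        then show "i \<in> {i. (x, i) \<in> \<tau>}" using q(1) \<open>\<not> y\<close> False by simp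
      qed
    qed
    then have "{x} \<times> {0..n} \<subseteq> \<sigma>" using \<tau>(1) by auto
    then show False using R by blast
  qed
  ultimately show ?L by (simp add: linear_arcs_def)
qed

lemma multipath_complex_BP:
  assumes n: "n \<ge> 2"
  shows "multipath_complex (BP n) = (`) (polygon_arc n) ` cyclic_complex n"
proof -
  have mod_le: "Suc i mod Suc n \<le> n" for i using mod_less_divisor[of "Suc n" "Suc i"] by linarith
  have wf: "wf_digraph (with_proj (BP n))"
    by unfold_locales (auto simp: BP_def mod_le)
  have "multipath_complex (BP n) = {S. S \<noteq> {} \<and> S \<subseteq> parcs (BP n) \<and> linear_arcs S}"
    by (rule multipath_complex_eq[OF wf]) (simp add: parcs_BP)
  also have "\<dots> = (`) (polygon_arc n) ` cyclic_complex n"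
  proof (intro set_eqI iffI)
    fix S assume "S \<in> {S. S \<noteq> {} \<and> S \<subseteq> parcs (BP n) \<and> linear_arcs S}"
    then obtain \<sigma> where \<sigma>: "\<sigma> \<subseteq> UNIV \<times> {0..n}" "S = polygon_arc n ` \<sigma>" "S \<noteq> {}" "linear_arcs S"
      by (auto simp: parcs_BP subset_image_iff)
    then have "\<sigma> \<in> cyclic_complex n"
      using linear_polygon_arcs[OF n \<sigma>(1)] by (auto simp: cyclic_complex_def)
    then show "S \<in> (`) (polygon_arc n) ` cyclic_complex n" using \<sigma>(2) by blast
  next
    fix S assume "S \<in> (`) (polygon_arc n) ` cyclic_complex n"
    then obtain \<sigma> where \<sigma>: "\<sigma> \<in> cyclic_complex n" "S = polygon_arc n ` \<sigma>" by blast
    then have "\<sigma> \<subseteq> UNIV \<times> {0..n}" by (simp add: cyclic_complex_def)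
    then show "S \<in> {S. S \<noteq> {} \<and> S \<subseteq> parcs (BP n) \<and> linear_arcs S}"
      using \<sigma> linear_polygon_arcs[OF n, of \<sigma>] by (auto simp: cyclic_complex_def parcs_BP)
  qed
  finally show ?thesis .
qed

theorem theorem2p8:
  fixes n :: nat
  assumes "n \<ge> 2"
  shows "k_connected (\<lfloor>(real n - 1) / 2\<rfloor> - 1) (geometric_realization (multipath_complex (BP n)))"
proof -
  let ?q = "(n + 1) div 2"
  have "\<Union>(cyclic_complex n) \<subseteq> UNIV \<times> {0..n}" by (auto simp: cyclic_complex_def)
  then have inj: "inj_on (polygon_arc n) (\<Union>(cyclic_complex n))"
    by (rule inj_on_subset[OF inj_polygon_arc[OF assms]])
  have "complex_fills ?q (cyclic_complex n)"
    by (rule complex_fills_cyclic_complex[OF assms]) simp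
  then have "fills ?q (realization_points (multipath_complex (BP n)))"
    unfolding multipath_complex_BP[OF assms]
    by (rule fills_image_complex[OF simplicial_cyclic_complex inj])
  moreover have "0 < ?q" using assms by simp
  \<comment> \<open>Both sides differ by exactly 1, as \<open>(n + 1) div 2\<close> is the floor of
    \<open>(n - 1) / 2\<close> plus 1. For \<open>n = 2\<close> this gives \<open>q = 1\<close>,
    where only nonemptiness is claimed.\<close>
  moreover have "\<lfloor>(real n - 1) / 2\<rfloor> < int ?q"
  proof -
    have "n \<le> 2 * ?q" by linarith
    then have "real n \<le> 2 * real ?q" by linarith
    then have "(real n - 1) / 2 < real_of_int (int ?q)" by simp
    then show ?thesis by (simp only: floor_less_iff)
  qed
  then have "\<lfloor>(real n - 1) / 2\<rfloor> - 1 + 2 \<le> int ?q" by simp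
  ultimately have "k_connected (\<lfloor>(real n - 1) / 2\<rfloor> - 1) (top_of_set (realization_points (multipath_complex (BP n))))"
    by (rule k_connected_fills)
  then show ?thesis by (simp add: geometric_realization_def euclidean_product_topology)
qed

end
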